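(* Let $(M,\Omega,D)$ be a Lagrangian Engel structure on a $4$-manifold $M$, with $I=D^\perp\subset T^*M$. Let $U\subset M$ be the domain on which $p_3\neq 0$, where for a $1$-adapted local coframing $\omega$ the function $p_3$ is defined by $\omega_1\wedge d\omega_1\wedge\omega_4=\tfrac{p_3}{2}\,\Omega\wedge\Omega$. Then on $U$ there exists a unique $0$-adapted coframing $\omega=(\omega_1,\omega_2,\omega_3,\omega_4)$ satisfying $$d\omega_1=\omega_3\wedge\omega_2+(a\,\omega_3+b\,\omega_4)\wedge\omega_1,$$ $$d\omega_2=(c\,\omega_2+e\,\omega_3+f\,\omega_4)\wedge\omega_1+\omega_3\wedge\omega_4,$$ for some functions $a,b,c,e,f$ on $U$.
   Context: Everything is smooth. An Engel structure on a $4$-manifold $M$ is a rank $2$ subbundle $D\subset TM$ such that, writing $I=D^\perp\subset T^*M$ for its annihilator, the first derived system $I^{(1)}$ has rank $1$ and the second derived system $I^{(2)}$ is $0$. Here, for a Pfaffian system (subbundle) $J\subset T^*M$, the derived system $J^{(1)}$ is the kernel of the bundle map $\delta:J\to\Lambda^2(T^*M/J)$ induced by $\omega\mapsto d\omega \bmod J$, and $I^{(2)}=(I^{(1)})^{(1)}$. A Lagrangian Engel structure $(M,\Omega,D)$ is a $4$-manifold $M$ with a symplectic form $\Omega$ and an Engel structure $D$ whose $2$-planes are Lagrangian for $\Omega$. A (local) coframing $\omega=(\omega_1,\omega_2,\omega_3,\omega_4)$ is $0$-adapted to $(M,\Omega,D)$ if $\Omega=\omega_1\wedge\omega_3+\omega_2\wedge\omega_4$,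 $I=\langle\omega_1,\omega_2\rangle$ and $I^{(1)}=\langle\omega_1\rangle$. It is $1$-adapted if moreover $d\omega_2\equiv\omega_3\wedge\omega_4 \bmod \omega_1,\omega_2$. $1$-adapted coframings exist locally, and one has $d\omega_1\equiv(p_3\omega_3+p_4\omega_4)\wedge\omega_2 \bmod \omega_1$ for functions $p_3,p_4$ with no common zeros. Changing the $1$-adapted coframing multiplies $p_3$ by a nowhere vanishing function, so the condition $p_3\ne0$ at a point is independent of the choice. *)

theory Defs
  imports "HOL-Analysis.Analysis"
begin

section \<open>Smooth maps on open sets of a normed space\<close>

primrec Ck_on :: "nat \<Rightarrow> 'a::real_normed_vector set \<Rightarrow> ('a \<Rightarrow> 'b::real_normed_vector) \<Rightarrow> bool" where
  "Ck_on 0 S f \<longleftrightarrow> continuous_on S f"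
| "Ck_on (Suc k) S f \<longleftrightarrow> (\<forall>x\<in>S. f differentiable at x) \<and>
     (\<forall>v. Ck_on k S (\<lambda>x. frechet_derivative f (at x) v))"

text \<open>Only used for open \<open>S\<close>.\<close>

definition smooth_on :: "'a::real_normed_vector set \<Rightarrow> ('a \<Rightarrow> 'b::real_normed_vector) \<Rightarrow> bool" where
  "smooth_on S f \<longleftrightarrow> (\<forall>k. Ck_on k S f)"


section \<open>Smooth manifolds\<close>

text \<open>A chart is a pair of its domain and its coordinate map. A manifold is a topological space
  \<open>X\<close> with a smooth atlas \<open>A\<close>, modelled on a Euclidean space \<open>'e\<close> of the dimension of the
  manifold. The atlas need not be maximal.\<close>

type_synonym ('a, 'e) chart = "'a set \<times> ('a \<Rightarrow> 'e)"

abbreviation chart_inv :: "('a, 'e) chart \<Rightarrow> 'e \<Rightarrow> 'a" where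
  "chart_inv c \<equiv> inv_into (fst c) (snd c)"

definition transition :: "('a, 'e) chart \<Rightarrow> ('a, 'e) chart \<Rightarrow> 'e \<Rightarrow> 'e" where
  "transition c c' = snd c' \<circ> chart_inv c"

definition smooth_manifold :: "'a topology \<Rightarrow> ('a, 'e::euclidean_space) chart set \<Rightarrow> bool" where
  "smooth_manifold X A \<longleftrightarrow>
     Hausdorff_space X \<and>
     (\<exists>\<B>. countable \<B> \<and> (\<forall>B\<in>\<B>. openin X B) \<and>
        (\<forall>W p. openin X W \<and> p \<in> W \<longrightarrow> (\<exists>B\<in>\<B>. p \<in> B \<and> B \<subseteq> W))) \<and>
     (\<Union>c\<in>A. fst c) = topspace X \<and>
     (\<forall>c\<in>A. openin X (fst c) \<and> open (snd c ` fst c) \<and>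
        homeomorphic_map (subtopology X (fst c)) (top_of_set (snd c ` fst c)) (snd c)) \<and>
     (\<forall>c\<in>A. \<forall>c'\<in>A. smooth_on (snd c ` (fst c \<inter> fst c')) (transition c c'))"

definition smooth_fun :: "('a, 'e::euclidean_space) chart set \<Rightarrow> 'a set \<Rightarrow> ('a \<Rightarrow> real) \<Rightarrow> bool" where
  "smooth_fun A V f \<longleftrightarrow> (\<forall>c\<in>A. smooth_on (snd c ` (fst c \<inter> V)) (f \<circ> chart_inv c))"


section \<open>Tangent vectors\<close>

text \<open>The tangent space at \<open>p\<close> is realised as the model space \<open>'e\<close>, by means of one preferred
  chart around \<open>p\<close>: a vector \<open>v :: 'e\<close> at \<open>p\<close> stands for the tangent vector with components
  \<open>v\<close> in the chart \<open>chart_at A p\<close>. Since the preferred chart may jump from point to point, every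
  notion involving more than one point (smoothness, the exterior derivative) first moves to the
  components with respect to a single chart, by the Jacobians \<open>jac\<close>.\<close>

definition chart_at :: "('a, 'e) chart set \<Rightarrow> 'a \<Rightarrow> ('a, 'e) chart" where
  "chart_at A p = (SOME c. c \<in> A \<and> p \<in> fst c)"

definition jac :: "('a, 'e::euclidean_space) chart \<Rightarrow> ('a, 'e) chart \<Rightarrow> 'a \<Rightarrow> 'e \<Rightarrow> 'e" where
  "jac c c' p = frechet_derivative (transition c c') (at (snd c p))"

definition smooth_vector_field ::
  "('a, 'e::euclidean_space) chart set \<Rightarrow> 'a set \<Rightarrow> ('a \<Rightarrow> 'e) \<Rightarrow> bool" where
  "smooth_vector_field A V Y \<longleftrightarrow>
     (\<forall>c\<in>A. smooth_on (snd c ` (fst c \<inter> V))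
        (\<lambda>x. let p = chart_inv c x in jac (chart_at A p) c p (Y p)))"

definition tangent_subbundle ::
  "'a topology \<Rightarrow> ('a, 'e::euclidean_space) chart set \<Rightarrow> nat \<Rightarrow> ('a \<Rightarrow> 'e set) \<Rightarrow> bool" where
  "tangent_subbundle X A r D \<longleftrightarrow>
     (\<forall>p\<in>topspace X. \<exists>V Y. openin X V \<and> p \<in> V \<and>
        (\<forall>i<r. smooth_vector_field A V (Y i)) \<and>
        (\<forall>q\<in>V. dim (D q) = r \<and> D q = span ((\<lambda>i. Y i q) ` {..<r})))"


section \<open>Differential forms\<close>

text \<open>A \<open>k\<close>-covector is an alternating \<open>k\<close>-linear function of lists of length \<open>k\<close>; its values on
  lists of other lengths are irrelevant.\<close>

type_synonym 'e form = "'e list \<Rightarrow> real"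

definition alternating_form :: "nat \<Rightarrow> 'e::euclidean_space form \<Rightarrow> bool" where
  "alternating_form k \<alpha> \<longleftrightarrow> (\<forall>vs. length vs = k \<longrightarrow>
     (\<forall>i<k. linear (\<lambda>x. \<alpha> (vs[i := x]))) \<and> (\<not> distinct vs \<longrightarrow> \<alpha> vs = 0))"

text \<open>The wedge product of a \<open>k\<close>-covector and an \<open>l\<close>-covector.\<close>

definition wedge :: "nat \<Rightarrow> nat \<Rightarrow> 'e form \<Rightarrow> 'e form \<Rightarrow> 'e form" where
  "wedge k l \<alpha> \<beta> vs =
     (\<Sum>\<sigma> | \<sigma> permutes {..<k+l}. of_int (sign \<sigma>) *
        \<alpha> (map (\<lambda>i. vs ! \<sigma> i) [0..<k]) * \<beta> (map (\<lambda>i. vs ! \<sigma> i) [k..<k+l]))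
     / (fact k * fact l)"

text \<open>Elements of the cotangent space have their own type, which makes it a vector space; \<open>cov\<close>
  regards them as \<open>1\<close>-covectors in the above sense.\<close>

type_synonym 'e covector = "'e \<Rightarrow>\<^sub>L real"

definition cov :: "'e::euclidean_space covector \<Rightarrow> 'e form" where
  "cov \<alpha> vs = blinfun_apply \<alpha> (hd vs)"

abbreviation wedge_cov ::
  "'e::euclidean_space covector \<Rightarrow> 'e covector \<Rightarrow> 'e form" (infixl "\<^bold>\<and>" 70) where
  "\<alpha> \<^bold>\<and> \<beta> \<equiv> wedge 1 1 (cov \<alpha>) (cov \<beta>)"

lemma wedge_cov_apply:
  "(\<alpha> \<^bold>\<and> \<beta>) [u, v] = blinfun_apply \<alpha> u * blinfun_apply \<beta> v - blinfun_apply \<alpha> v * blinfun_apply \<beta> u"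
proof -
  have "{..<1 + 1} = insert 0 {1 :: nat}" by auto
  then show ?thesis
    unfolding wedge_def
    by (simp add: cov_def sum_over_permutations_insert permutes_sing sign_swap_id sign_id
        transpose_def)
qed

text \<open>The coefficient function of a field of covectors with respect to the chart \<open>c\<close>: the point
  has coordinates \<open>x\<close> and the arguments have components \<open>vs\<close> in this chart.\<close>

definition in_chart ::
  "('a, 'e::euclidean_space) chart set \<Rightarrow> ('a, 'e) chart \<Rightarrow> ('a \<Rightarrow> 'e form) \<Rightarrow> 'e \<Rightarrow> 'e form" where
  "in_chart A c \<alpha> x vs = (let p = chart_inv c x in \<alpha> p (map (jac c (chart_at A p) p) vs))"

definition smooth_form ::
  "('a, 'e::euclidean_space) chart set \<Rightarrow> nat \<Rightarrow> 'a set \<Rightarrow> ('a \<Rightarrow> 'e form) \<Rightarrow> bool" where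
  "smooth_form A k V \<alpha> \<longleftrightarrow> (\<forall>p\<in>V. alternating_form k (\<alpha> p)) \<and>
     (\<forall>c\<in>A. \<forall>vs. length vs = k \<longrightarrow>
        smooth_on (snd c ` (fst c \<inter> V)) (\<lambda>x. in_chart A c \<alpha> x vs))"

text \<open>The exterior derivative, computed in the preferred chart at \<open>p\<close>:
  \<open>d\<alpha>(v\<^sub>0, \<dots>, v\<^sub>k) = \<Sum>\<^sub>i (-1)\<^sup>i D\<alpha>(v\<^sub>i)(v\<^sub>0, \<dots>, v\<^sub>k without v\<^sub>i)\<close>.\<close>

definition ext_d ::
  "('a, 'e::euclidean_space) chart set \<Rightarrow> ('a \<Rightarrow> 'e form) \<Rightarrow> 'a \<Rightarrow> 'e form" where
  "ext_d A \<alpha> p vs = (let c = chart_at A p in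
     \<Sum>i<length vs. (-1) ^ i *
       frechet_derivative (\<lambda>x. in_chart A c \<alpha> x (take i vs @ drop (Suc i) vs))
         (at (snd c p)) (vs ! i))"

abbreviation smooth_1form ::
  "('a, 'e::euclidean_space) chart set \<Rightarrow> 'a set \<Rightarrow> ('a \<Rightarrow> 'e covector) \<Rightarrow> bool" where
  "smooth_1form A V \<theta> \<equiv> smooth_form A 1 V (\<lambda>q. cov (\<theta> q))"

abbreviation d1 ::
  "('a, 'e::euclidean_space) chart set \<Rightarrow> ('a \<Rightarrow> 'e covector) \<Rightarrow> 'a \<Rightarrow> 'e form" where
  "d1 A \<theta> \<equiv> ext_d A (\<lambda>q. cov (\<theta> q))"


section \<open>Pfaffian systems and Engel structures\<close>

definition cotangent_subbundle ::
  "'a topology \<Rightarrow> ('a, 'e::euclidean_space) chart set \<Rightarrow> nat \<Rightarrow> ('a \<Rightarrow> 'e covector set) \<Rightarrow> bool" where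
  "cotangent_subbundle X A r J \<longleftrightarrow>
     (\<forall>p\<in>topspace X. \<exists>V \<theta>. openin X V \<and> p \<in> V \<and>
        (\<forall>i<r. smooth_1form A V (\<theta> i)) \<and>
        (\<forall>q\<in>V. dim (J q) = r \<and> J q = span ((\<lambda>i. \<theta> i q) ` {..<r})))"

definition annihilator :: "('a \<Rightarrow> 'e::euclidean_space set) \<Rightarrow> 'a \<Rightarrow> 'e covector set" where
  "annihilator D p = {\<alpha>. \<forall>v\<in>D p. blinfun_apply \<alpha> v = 0}"

text \<open>Congruence of \<open>2\<close>-covectors modulo the algebraic ideal generated by a set \<open>J\<close> of covectors.
  For a subspace \<open>J\<close> of the cotangent space \<open>T\<close> this is equality of the images in \<open>\<Lambda>\<^sup>2(T/J)\<close>.\<close>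

definition cong2_mod :: "'e::euclidean_space covector set \<Rightarrow> 'e form \<Rightarrow> 'e form \<Rightarrow> bool" where
  "cong2_mod J \<eta> \<eta>' \<longleftrightarrow> (\<exists>(n::nat) \<alpha> \<beta>. (\<forall>i<n. \<alpha> i \<in> J) \<and>
     (\<forall>u v. \<eta> [u, v] = \<eta>' [u, v] + (\<Sum>i<n. (\<alpha> i \<^bold>\<and> \<beta> i) [u, v])))"

text \<open>The bundle map \<open>\<delta>\<close> sends the value at \<open>p\<close> of a local section \<open>\<theta>\<close> of \<open>J\<close> to the class of
  \<open>d\<theta>\<close> at \<open>p\<close>, which depends only on that value; the derived system is the kernel of \<open>\<delta>\<close>.\<close>

definition derived_system ::
  "'a topology \<Rightarrow> ('a, 'e::euclidean_space) chart set \<Rightarrow> ('a \<Rightarrow> 'e covector set) \<Rightarrow>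
   'a \<Rightarrow> 'e covector set" where
  "derived_system X A J p = {\<alpha>. \<exists>V \<theta>. openin X V \<and> p \<in> V \<and> smooth_1form A V \<theta> \<and>
     (\<forall>q\<in>V. \<theta> q \<in> J q) \<and> \<theta> p = \<alpha> \<and> cong2_mod (J p) (d1 A \<theta> p) (\<lambda>_. 0)}"

definition engel_structure ::
  "'a topology \<Rightarrow> ('a, real^4) chart set \<Rightarrow> ('a \<Rightarrow> (real^4) set) \<Rightarrow> bool" where
  "engel_structure X A D \<longleftrightarrow> tangent_subbundle X A 2 D \<and>
     cotangent_subbundle X A 1 (derived_system X A (annihilator D)) \<and>
     (\<forall>p\<in>topspace X. derived_system X A (derived_system X A (annihilator D)) p = {0})"

definition symplectic_form ::
  "'a topology \<Rightarrow> ('a, 'e::euclidean_space) chart set \<Rightarrow> ('a \<Rightarrow> 'e form) \<Rightarrow> bool" where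
  "symplectic_form X A \<Omega> \<longleftrightarrow> smooth_form A 2 (topspace X) \<Omega> \<and>
     (\<forall>p\<in>topspace X.
        (\<forall>u v w. ext_d A \<Omega> p [u, v, w] = 0) \<and>
        (\<forall>u. u \<noteq> 0 \<longrightarrow> (\<exists>v. \<Omega> p [u, v] \<noteq> 0)))"

text \<open>Planes in a \<open>4\<close>-dimensional symplectic vector space are Lagrangian iff they are isotropic.\<close>

definition lagrangian_engel_structure ::
  "'a topology \<Rightarrow> ('a, real^4) chart set \<Rightarrow> ('a \<Rightarrow> (real^4) form) \<Rightarrow> ('a \<Rightarrow> (real^4) set) \<Rightarrow> bool" where
  "lagrangian_engel_structure X A \<Omega> D \<longleftrightarrow> smooth_manifold X A \<and> symplectic_form X A \<Omega> \<and>
     engel_structure X A D \<and> (\<forall>p\<in>topspace X. \<forall>u\<in>D p. \<forall>v\<in>D p. \<Omega> p [u, v] = 0)"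


section \<open>Adapted coframings\<close>

text \<open>The members of a coframing \<open>\<omega>\<close> on \<open>V\<close> are \<open>\<omega> 1, \<dots>, \<omega> 4\<close>.\<close>

definition coframing ::
  "('a, real^4) chart set \<Rightarrow> 'a set \<Rightarrow> (nat \<Rightarrow> 'a \<Rightarrow> (real^4) covector) \<Rightarrow> bool" where
  "coframing A V \<omega> \<longleftrightarrow> (\<forall>i\<in>{1..4}. smooth_1form A V (\<omega> i)) \<and>
     (\<forall>p\<in>V. inj_on (\<lambda>i. \<omega> i p) {1..4} \<and> independent ((\<lambda>i. \<omega> i p) ` {1..4}))"

definition zero_adapted ::
  "'a topology \<Rightarrow> ('a, real^4) chart set \<Rightarrow> ('a \<Rightarrow> (real^4) form) \<Rightarrow> ('a \<Rightarrow> (real^4) set) \<Rightarrow>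
   'a set \<Rightarrow> (nat \<Rightarrow> 'a \<Rightarrow> (real^4) covector) \<Rightarrow> bool" where
  "zero_adapted X A \<Omega> D V \<omega> \<longleftrightarrow> coframing A V \<omega> \<and>
     (\<forall>p\<in>V.
        (\<forall>u v. \<Omega> p [u, v] = (\<omega> 1 p \<^bold>\<and> \<omega> 3 p) [u, v] + (\<omega> 2 p \<^bold>\<and> \<omega> 4 p) [u, v]) \<and>
        annihilator D p = span {\<omega> 1 p, \<omega> 2 p} \<and>
        derived_system X A (annihilator D) p = span {\<omega> 1 p})"

definition one_adapted ::
  "'a topology \<Rightarrow> ('a, real^4) chart set \<Rightarrow> ('a \<Rightarrow> (real^4) form) \<Rightarrow> ('a \<Rightarrow> (real^4) set) \<Rightarrow>
   'a set \<Rightarrow> (nat \<Rightarrow> 'a \<Rightarrow> (real^4) covector) \<Rightarrow> bool" where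
  "one_adapted X A \<Omega> D V \<omega> \<longleftrightarrow> zero_adapted X A \<Omega> D V \<omega> \<and>
     (\<forall>p\<in>V. cong2_mod {\<omega> 1 p, \<omega> 2 p} (d1 A (\<omega> 2) p) (\<omega> 3 p \<^bold>\<and> \<omega> 4 p))"

text \<open>The function with \<open>\<omega>\<^sub>1 \<and> d\<omega>\<^sub>1 \<and> \<omega>\<^sub>4 = (p\<^sub>3 / 2) \<Omega> \<and> \<Omega>\<close>; it is well defined since
  \<open>\<Omega> \<and> \<Omega>\<close> is a volume form.\<close>

definition p3 ::
  "('a, real^4) chart set \<Rightarrow> ('a \<Rightarrow> (real^4) form) \<Rightarrow> (nat \<Rightarrow> 'a \<Rightarrow> (real^4) covector) \<Rightarrow> 'a \<Rightarrow> real" where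
  "p3 A \<Omega> \<omega> p = (THE t. \<forall>vs. length vs = 4 \<longrightarrow>
     wedge 3 1 (wedge 1 2 (cov (\<omega> 1 p)) (d1 A (\<omega> 1) p)) (cov (\<omega> 4 p)) vs =
     t / 2 * wedge 2 2 (\<Omega> p) (\<Omega> p) vs)"

text \<open>The condition \<open>p\<^sub>3 \<noteq> 0\<close> at \<open>p\<close> does not depend on the \<open>1\<close>-adapted coframing around \<open>p\<close>.\<close>

definition p3_domain ::
  "'a topology \<Rightarrow> ('a, real^4) chart set \<Rightarrow> ('a \<Rightarrow> (real^4) form) \<Rightarrow> ('a \<Rightarrow> (real^4) set) \<Rightarrow> 'a set" where
  "p3_domain X A \<Omega> D = {p. \<exists>V \<omega>. openin X V \<and> p \<in> V \<and> one_adapted X A \<Omega> D V \<omega> \<and> p3 A \<Omega> \<omega> p \<noteq> 0}"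

definition structure_equations ::
  "('a, real^4) chart set \<Rightarrow> 'a set \<Rightarrow> (nat \<Rightarrow> 'a \<Rightarrow> (real^4) covector) \<Rightarrow>
   ('a \<Rightarrow> real) \<Rightarrow> ('a \<Rightarrow> real) \<Rightarrow> ('a \<Rightarrow> real) \<Rightarrow> ('a \<Rightarrow> real) \<Rightarrow> ('a \<Rightarrow> real) \<Rightarrow> bool" where
  "structure_equations A U \<omega> a b c e f \<longleftrightarrow> (\<forall>p\<in>U. \<forall>u v.
     d1 A (\<omega> 1) p [u, v] =
       (\<omega> 3 p \<^bold>\<and> \<omega> 2 p) [u, v] + ((a p *\<^sub>R \<omega> 3 p + b p *\<^sub>R \<omega> 4 p) \<^bold>\<and> \<omega> 1 p) [u, v] \<and>
     d1 A (\<omega> 2) p [u, v] =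
       ((c p *\<^sub>R \<omega> 2 p + e p *\<^sub>R \<omega> 3 p + f p *\<^sub>R \<omega> 4 p) \<^bold>\<and> \<omega> 1 p) [u, v] +
       (\<omega> 3 p \<^bold>\<and> \<omega> 4 p) [u, v])"

definition structure_coframing ::
  "'a topology \<Rightarrow> ('a, real^4) chart set \<Rightarrow> ('a \<Rightarrow> (real^4) form) \<Rightarrow> ('a \<Rightarrow> (real^4) set) \<Rightarrow>
   'a set \<Rightarrow> (nat \<Rightarrow> 'a \<Rightarrow> (real^4) covector) \<Rightarrow> bool" where
  "structure_coframing X A \<Omega> D U \<omega> \<longleftrightarrow> zero_adapted X A \<Omega> D U \<omega> \<and>
     (\<exists>a b c e f. smooth_fun A U a \<and> smooth_fun A U b \<and> smooth_fun A U c \<and>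
        smooth_fun A U e \<and> smooth_fun A U f \<and> structure_equations A U \<omega> a b c e f)"

end

theory Submission
  imports Defs
begin

text \<open>Let \<open>E\<^sub>1, \<dots>, E\<^sub>4\<close> be the frame dual to a \<open>0\<close>-adapted coframing. The structure equations say
  that \<open>d\<omega>\<^sub>1\<close> takes the values \<open>0, 1, 0, 0\<close> on the pairs \<open>(E\<^sub>3, E\<^sub>4)\<close>, \<open>(E\<^sub>3, E\<^sub>2)\<close>,
  \<open>(E\<^sub>4, E\<^sub>2)\<close>, \<open>(E\<^sub>2, E\<^sub>1)\<close>, and \<open>d\<omega>\<^sub>2\<close> the values \<open>1, 0, 0\<close> on the first three. The
  \<open>0\<close>-adapted coframings are related by \<open>\<omega>\<^sub>1 \<mapsto> a \<omega>\<^sub>1\<close>, \<open>\<omega>\<^sub>2 \<mapsto> b \<omega>\<^sub>2 + c \<omega>\<^sub>1\<close>, which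
  determines \<open>\<omega>\<^sub>3, \<omega>\<^sub>4\<close> up to adding a symmetric combination of \<open>\<omega>\<^sub>1, \<omega>\<^sub>2\<close>. The first
  value of \<open>d\<omega>\<^sub>1\<close> is automatic; the next two and the first of \<open>d\<omega>\<^sub>2\<close> amount to \<open>a b\<^sup>2 = 1\<close>,
  \<open>b\<^sup>5 = p\<^sub>3\<close> and a linear equation for \<open>c\<close>, which over the reals have exactly one solution
  where \<open>p\<^sub>3 \<noteq> 0\<close>; it is smooth. Then \<open>\<omega>\<^sub>1, \<omega>\<^sub>2\<close> and their differentials are fixed, and the
  other three conditions are a triangular linear system for the symmetric combination. Pointwise
  uniqueness lets the local solutions be glued.\<close>

section \<open>Calculus of smooth functions\<close>

text \<open>The exponent 5 is a matter of weights. If \<open>\<omega> 3\<close>,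
  \<open>\<omega> 4\<close> are scaled by 1/a, 1/b, then E3, E2 are scaled by a, 1/b, so p3 is
  multiplied by a^2/b, that is by b^(-5) once a b^2 = 1. As 5 is odd, the real root exists for
  either sign, is unique, and is smooth away from zero. The system for a, b, c is algebraic although
  the unknowns are functions: replacing a form \<theta> by f \<theta> adds df \<and> \<theta> to the
  differential, and each condition fixing a, b, c is evaluated on vectors on which these extra terms
  vanish. The symmetric combination then leaves \<open>\<omega> 1\<close> and
  \<open>\<omega> 2\<close> alone. The main labour is smoothness. A vector at p is given by
  components in \<open>chart_at A p\<close>, which may jump with p, so \<open>d1\<close> at
  neighbouring points is computed in unrelated charts and its coefficients are not visibly smooth.
  This calls for coordinate invariance of the exterior derivative, hence for symmetry of second
  derivatives, and for Cramer's rule to make dual frames smooth.\<close>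

lemma Ck_on_cong:
  assumes "open S" "\<And>x. x \<in> S \<Longrightarrow> f x = g x" "Ck_on k S f"
  shows "Ck_on k S g"
  using assms(2,3)
proof (induction k arbitrary: f g)
  case 0
  then show ?case by (simp cong: continuous_on_cong)
next
  case (Suc k)
  have der: "(g has_derivative frechet_derivative f (at x)) (at x)" if "x \<in> S" for x
  proof (rule has_derivative_transform_within_open[OF _ assms(1) that])
    show "(f has_derivative frechet_derivative f (at x)) (at x)"
      using Suc.prems(2) that by (simp add: frechet_derivative_works[symmetric])
  qed (use Suc.prems in auto)
  then have "frechet_derivative g (at x) = frechet_derivative f (at x)" if "x \<in> S" for x
    using frechet_derivative_at that by metis
  then have "Ck_on k S (\<lambda>x. frechet_derivative g (at x) v)" for v
    using Suc.IH[of "\<lambda>x. frechet_derivative f (at x) v"] Suc.prems by simp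
  with der show ?case by (auto simp: differentiable_def)
qed

lemma Ck_on_subset: "Ck_on k S f \<Longrightarrow> T \<subseteq> S \<Longrightarrow> Ck_on k T f"
  by (induction k arbitrary: f) (auto intro: continuous_on_subset)

lemma Ck_on_local:
  assumes "\<And>x. x \<in> S \<Longrightarrow> \<exists>T. open T \<and> x \<in> T \<and> Ck_on k T f"
  shows "Ck_on k S f"
  using assms
proof (induction k arbitrary: f)
  case 0
  have "isCont f x" if "x \<in> S" for x
    using 0[OF that] by (auto simp: continuous_on_eq_continuous_at)
  then show ?case by (simp add: continuous_at_imp_continuous_on)
next
  case (Suc k)
  have "f differentiable at x" if "x \<in> S" for x
    using Suc.prems[OF that] by auto
  moreover have "Ck_on k S (\<lambda>x. frechet_derivative f (at x) v)" for v
  proof (rule Suc.IH)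
    fix x assume "x \<in> S"
    from Suc.prems[OF this] show "\<exists>T. open T \<and> x \<in> T \<and> Ck_on k T (\<lambda>x. frechet_derivative f (at x) v)"
      by auto
  qed
  ultimately show ?case by simp
qed

lemma Ck_on_Suc_imp: "Ck_on (Suc k) S f \<Longrightarrow> Ck_on k S f"
proof (induction k arbitrary: f)
  case 0
  then show ?case
    by (simp add: differentiable_imp_continuous_within continuous_at_imp_continuous_on)
next
  case (Suc k)
  have "Ck_on k S (\<lambda>x. frechet_derivative f (at x) v)" for v
    using Suc.prems by (intro Suc.IH) simp
  then show ?case using Suc.prems by simp
qed

text \<open>Uniqueness of derivatives lets an explicit formula stand in for the chosen
  \<open>frechet_derivative\<close>; all closure properties below go through this rule.\<close>

lemma Ck_on_SucI:
  assumes "open S" "\<And>x. x \<in> S \<Longrightarrow> (f has_derivative f' x) (at x)" "\<And>v. Ck_on k S (\<lambda>x. f' x v)"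
  shows "Ck_on (Suc k) S f"
proof -
  have "frechet_derivative f (at x) = f' x" if "x \<in> S" for x
    using assms(2)[OF that] frechet_derivative_at by metis
  then have "Ck_on k S (\<lambda>x. frechet_derivative f (at x) v)" for v
    using Ck_on_cong[OF assms(1) _ assms(3)[of v]] by simp
  then show ?thesis using assms(2) by (auto simp: differentiable_def)
qed

lemma Ck_on_SucD:
  assumes "Ck_on (Suc k) S f" "x \<in> S"
  shows "(f has_derivative frechet_derivative f (at x)) (at x)"
  using assms by (simp add: frechet_derivative_works[symmetric])

lemma Ck_on_const [simp]: "Ck_on k S (\<lambda>x. c)"
  by (induction k arbitrary: c) auto

lemma Ck_on_add:
  assumes "open S" "Ck_on k S f" "Ck_on k S g"
  shows "Ck_on k S (\<lambda>x. f x + g x)"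
  using assms(2,3)
proof (induction k arbitrary: f g)
  case (Suc k)
  show ?case
    by (rule Ck_on_SucI[OF assms(1) has_derivative_add[OF Ck_on_SucD Ck_on_SucD]])
      (use Suc in auto)
qed (auto intro: continuous_intros)

lemma Ck_on_bounded_linear:
  assumes "open S" "bounded_linear L" "Ck_on k S f"
  shows "Ck_on k S (\<lambda>x. L (f x))"
  using assms(3)
proof (induction k arbitrary: f)
  case 0
  then show ?case by (simp add: bounded_linear.continuous_on[OF assms(2)])
next
  case (Suc k)
  show ?case
    by (rule Ck_on_SucI[OF assms(1) bounded_linear.has_derivative[OF assms(2) Ck_on_SucD]])
      (use Suc in auto)
qed

lemma Ck_on_mult:
  fixes f g :: "'a::real_normed_vector \<Rightarrow> real"
  assumes "open S" "Ck_on k S f" "Ck_on k S g"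
  shows "Ck_on k S (\<lambda>x. f x * g x)"
  using assms(2,3)
proof (induction k arbitrary: f g)
  case (Suc k)
  \<comment> \<open>The product rule contains \<open>f\<close> and \<open>g\<close>
    undifferentiated, so they are also needed at the lower order.\<close>
  have "Ck_on k S f" "Ck_on k S g"
    using Suc.prems Ck_on_Suc_imp by blast+
  with Suc show ?case
    by (intro Ck_on_SucI[OF assms(1) has_derivative_mult[OF Ck_on_SucD Ck_on_SucD]] Ck_on_add)
      (auto intro: assms(1))
qed (auto intro: continuous_intros)

text \<open>The derivative is a polynomial in 1/f and f', so the induction hypothesis for the same
  \<open>f\<close> already covers the factors 1/f.\<close>

lemma Ck_on_inverse:
  fixes f :: "'a::real_normed_vector \<Rightarrow> real"
  assumes "open S" "\<And>x. x \<in> S \<Longrightarrow> f x \<noteq> 0" "Ck_on k S f"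
  shows "Ck_on k S (\<lambda>x. inverse (f x))"
  using assms(3)
proof (induction k)
  case 0
  then show ?case using assms(2) by (auto intro: continuous_intros)
next
  case (Suc k)
  have *: "Ck_on k S (\<lambda>x. inverse (f x))"
    using Suc Ck_on_Suc_imp by blast
  show ?case
  proof (rule Ck_on_SucI[OF assms(1)])
    show "((\<lambda>x. inverse (f x)) has_derivative
      (\<lambda>v. (-1) * ((inverse (f x) * frechet_derivative f (at x) v) * inverse (f x)))) (at x)"
      if "x \<in> S" for x
      using Deriv.has_derivative_inverse[OF assms(2)[OF that] Ck_on_SucD[OF Suc.prems that]] by simp
    show "Ck_on k S (\<lambda>x. (-1) * ((inverse (f x) * frechet_derivative f (at x) v) * inverse (f x)))" for v
      by (intro Ck_on_mult Ck_on_const assms(1) *) (use Suc.prems in simp)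
  qed
qed

text \<open>Writing the derivative of the root as root(f) / (n f), rather than with a power of the
  root, expresses it through functions whose order \<open>k\<close> is already known. An odd
  \<open>n\<close> admits negative values of \<open>f\<close>.\<close>

lemma Ck_on_root:
  fixes f :: "'a::real_normed_vector \<Rightarrow> real"
  assumes "open S" "odd n" "\<And>x. x \<in> S \<Longrightarrow> f x \<noteq> 0" "Ck_on k S f"
  shows "Ck_on k S (\<lambda>x. root n (f x))"
  using assms(4)
proof (induction k)
  case 0
  then show ?case by (auto intro: continuous_intros)
next
  case (Suc k)
  have n: "n > 0" using assms(2) by (cases n) auto
  have *: "Ck_on k S (\<lambda>x. root n (f x))" "Ck_on k S f"
    using Suc Ck_on_Suc_imp by blast+
  show ?case
  proof (rule Ck_on_SucI[OF assms(1)])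
    fix x assume x: "x \<in> S"
    have nz: "f x \<noteq> 0" using assms(3) x .
    have "DERIV (root n) (f x) :> inverse (real n * root n (f x) ^ (n - Suc 0))"
      using DERIV_odd_real_root[OF assms(2) nz] .
    moreover have "inverse (real n * root n (f x) ^ (n - Suc 0))
        = inverse (real n) * root n (f x) * inverse (f x)"
    proof -
      have "root n (f x) ^ (n - Suc 0) * root n (f x) = f x"
        using odd_real_root_pow[OF assms(2), of "f x"] n by (cases n) (auto simp: mult.commute)
      then show ?thesis using nz n by (auto simp: field_simps)
    qed
    ultimately have "DERIV (root n) (f x) :> inverse (real n) * root n (f x) * inverse (f x)"
      by metis
    then have "(root n has_derivative (\<lambda>h. h * (inverse (real n) * root n (f x) * inverse (f x)))) (at (f x))"
      unfolding has_field_derivative_def by (simp add: mult_commute_abs)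
    from diff_chain_at[OF Ck_on_SucD[OF Suc.prems x] this]
    show "((\<lambda>x. root n (f x)) has_derivative
        (\<lambda>v. frechet_derivative f (at x) v * ((inverse (real n) * root n (f x)) * inverse (f x)))) (at x)"
      by (simp add: o_def)
  next
    show "Ck_on k S (\<lambda>x. frechet_derivative f (at x) v *
        ((inverse (real n) * root n (f x)) * inverse (f x)))" for v
      by (intro Ck_on_mult Ck_on_const Ck_on_inverse assms * ) (use Suc.prems in simp)
  qed
qed

lemma smooth_on_cong:
  "open S \<Longrightarrow> (\<And>x. x \<in> S \<Longrightarrow> f x = g x) \<Longrightarrow> smooth_on S f \<Longrightarrow> smooth_on S g"
  unfolding smooth_on_def by (auto intro: Ck_on_cong)

lemma smooth_on_subset: "smooth_on S f \<Longrightarrow> T \<subseteq> S \<Longrightarrow> smooth_on T f"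
  unfolding smooth_on_def by (auto intro: Ck_on_subset)

lemma smooth_on_local:
  assumes "\<And>x. x \<in> S \<Longrightarrow> \<exists>T. open T \<and> x \<in> T \<and> smooth_on T f"
  shows "smooth_on S f"
  unfolding smooth_on_def
proof
  show "Ck_on k S f" for k
    using assms by (intro Ck_on_local) (auto simp: smooth_on_def)
qed

lemma smooth_on_const [simp]: "smooth_on S (\<lambda>x. c)"
  by (simp add: smooth_on_def)

lemma smooth_on_add: "open S \<Longrightarrow> smooth_on S f \<Longrightarrow> smooth_on S g \<Longrightarrow> smooth_on S (\<lambda>x. f x + g x)"
  by (simp add: smooth_on_def Ck_on_add)

lemma smooth_on_bounded_linear:
  "open S \<Longrightarrow> bounded_linear L \<Longrightarrow> smooth_on S f \<Longrightarrow> smooth_on S (\<lambda>x. L (f x))"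
  by (simp add: smooth_on_def Ck_on_bounded_linear)

lemma smooth_on_mult:
  fixes f g :: "'a::real_normed_vector \<Rightarrow> real"
  shows "open S \<Longrightarrow> smooth_on S f \<Longrightarrow> smooth_on S g \<Longrightarrow> smooth_on S (\<lambda>x. f x * g x)"
  by (simp add: smooth_on_def Ck_on_mult)

lemma smooth_on_divide:
  fixes f g :: "'a::real_normed_vector \<Rightarrow> real"
  shows "open S \<Longrightarrow> smooth_on S f \<Longrightarrow> smooth_on S g \<Longrightarrow> (\<And>x. x \<in> S \<Longrightarrow> g x \<noteq> 0) \<Longrightarrow>
    smooth_on S (\<lambda>x. f x / g x)"
  unfolding divide_inverse smooth_on_def by (auto intro!: Ck_on_mult Ck_on_inverse)

lemma smooth_on_minus:
  fixes f :: "'a::real_normed_vector \<Rightarrow> real"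
  shows "open S \<Longrightarrow> smooth_on S f \<Longrightarrow> smooth_on S (\<lambda>x. - f x)"
  by (rule smooth_on_bounded_linear[OF _ bounded_linear_minus[OF bounded_linear_ident]])

lemma smooth_on_diff:
  fixes f g :: "'a::real_normed_vector \<Rightarrow> real"
  shows "open S \<Longrightarrow> smooth_on S f \<Longrightarrow> smooth_on S g \<Longrightarrow> smooth_on S (\<lambda>x. f x - g x)"
  using smooth_on_add[OF _ _ smooth_on_minus, of S f g] by simp

lemma smooth_on_sum:
  fixes f :: "'i \<Rightarrow> 'a::real_normed_vector \<Rightarrow> 'b::real_normed_vector"
  assumes "open S" "\<And>i. i \<in> I \<Longrightarrow> smooth_on S (f i)"
  shows "smooth_on S (\<lambda>x. \<Sum>i\<in>I. f i x)"
  using assms(2) by (induction I rule: infinite_finite_induct) (auto intro: smooth_on_add assms(1))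

lemma smooth_on_componentwise:
  fixes f :: "'a::real_normed_vector \<Rightarrow> 'b::euclidean_space"
  assumes "open S" "\<And>b. b \<in> Basis \<Longrightarrow> smooth_on S (\<lambda>x. f x \<bullet> b)"
  shows "smooth_on S f"
proof -
  have "smooth_on S (\<lambda>x. \<Sum>b\<in>Basis. (f x \<bullet> b) *\<^sub>R b)"
    by (rule smooth_on_sum[OF assms(1)])
      (rule smooth_on_bounded_linear[OF assms(1) bounded_linear_scaleR_left assms(2)])
  then show ?thesis by (simp add: euclidean_representation)
qed

lemma smooth_on_prod:
  fixes f :: "'i \<Rightarrow> 'a::real_normed_vector \<Rightarrow> real"
  assumes "open S" "\<And>i. i \<in> I \<Longrightarrow> smooth_on S (f i)"
  shows "smooth_on S (\<lambda>x. \<Prod>i\<in>I. f i x)"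
  using assms(2) by (induction I rule: infinite_finite_induct) (auto intro: smooth_on_mult assms(1))

lemma smooth_on_det:
  fixes M :: "'a::real_normed_vector \<Rightarrow> real^'n^'n"
  assumes "open S" "\<And>i j. smooth_on S (\<lambda>x. M x $ i $ j)"
  shows "smooth_on S (\<lambda>x. det (M x))"
  unfolding det_def by (intro smooth_on_sum smooth_on_mult smooth_on_prod smooth_on_const assms)

lemma smooth_on_root:
  fixes f :: "'a::real_normed_vector \<Rightarrow> real"
  shows "open S \<Longrightarrow> odd n \<Longrightarrow> (\<And>x. x \<in> S \<Longrightarrow> f x \<noteq> 0) \<Longrightarrow> smooth_on S f \<Longrightarrow>
    smooth_on S (\<lambda>x. root n (f x))"
  by (simp add: smooth_on_def Ck_on_root)

lemma smooth_on_frechet_derivative: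
  assumes "smooth_on S f"
  shows "smooth_on S (\<lambda>x. frechet_derivative f (at x) v)"
  unfolding smooth_on_def
proof
  show "Ck_on k S (\<lambda>x. frechet_derivative f (at x) v)" for k
    using assms[unfolded smooth_on_def, rule_format, of "Suc k"] by simp
qed

lemma smooth_on_has_derivative:
  "smooth_on S f \<Longrightarrow> x \<in> S \<Longrightarrow> (f has_derivative frechet_derivative f (at x)) (at x)"
  unfolding smooth_on_def by (auto intro: Ck_on_SucD)

lemma smooth_on_imp_continuous_on: "smooth_on S f \<Longrightarrow> continuous_on S f"
  unfolding smooth_on_def using Ck_on.simps(1)[of S f] by metis

section \<open>Symmetry of second derivatives\<close>

text \<open>The mean value theorem is applied twice: along \<open>u\<close> to the increment of
  \<open>f\<close> in direction \<open>h *\<^sub>R v\<close>, then along \<open>v\<close> to the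
  resulting derivative in direction \<open>u\<close>.\<close>

lemma second_difference_mvt:
  fixes f :: "'a::real_normed_vector \<Rightarrow> real"
  assumes "h > 0" and S: "\<And>s t. 0 \<le> s \<Longrightarrow> s \<le> h \<Longrightarrow> 0 \<le> t \<Longrightarrow> t \<le> h \<Longrightarrow> x + s *\<^sub>R u + t *\<^sub>R v \<in> S"
    and f: "\<And>y. y \<in> S \<Longrightarrow> (f has_derivative f' y) (at y)"
    and f': "\<And>y. y \<in> S \<Longrightarrow> ((\<lambda>y. f' y u) has_derivative f'' y) (at y)"
  shows "\<exists>s t. 0 < s \<and> s < h \<and> 0 < t \<and> t < h \<and>
    f (x + h *\<^sub>R u + h *\<^sub>R v) - f (x + h *\<^sub>R u) - f (x + h *\<^sub>R v) + f x
      = h * (h * f'' (x + s *\<^sub>R u + t *\<^sub>R v) v)"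
proof -
  \<comment> \<open>The terms with factor 0 are kept so that one derivative computation, at t = h
    and at t = 0, serves both halves of the increment.\<close>
  have "\<exists>s. 0 < s \<and> s < h \<and>
      (f (x + h *\<^sub>R u + h *\<^sub>R v) - f (x + h *\<^sub>R u + 0 *\<^sub>R v))
      - (f (x + 0 *\<^sub>R u + h *\<^sub>R v) - f (x + 0 *\<^sub>R u + 0 *\<^sub>R v))
      = (h - 0) * (f' (x + s *\<^sub>R u + h *\<^sub>R v) u - f' (x + s *\<^sub>R u + 0 *\<^sub>R v) u)"
  proof (rule MVT2[OF \<open>h > 0\<close>])
    fix s assume s: "0 \<le> s" "s \<le> h"
    have *: "((\<lambda>s. f (x + s *\<^sub>R u + t *\<^sub>R v)) has_real_derivative f' (x + s *\<^sub>R u + t *\<^sub>R v) u) (at s)"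
      if t: "0 \<le> t" "t \<le> h" for t
    proof -
      have "((\<lambda>s. x + s *\<^sub>R u + t *\<^sub>R v) has_derivative (\<lambda>r. r *\<^sub>R u)) (at s)"
        by (auto intro!: derivative_eq_intros)
      from diff_chain_at[OF this f[OF S[OF s t]]]
      have "((\<lambda>s. f (x + s *\<^sub>R u + t *\<^sub>R v)) has_derivative (\<lambda>r. f' (x + s *\<^sub>R u + t *\<^sub>R v) (r *\<^sub>R u))) (at s)"
        by (simp add: o_def)
      moreover have "linear (f' (x + s *\<^sub>R u + t *\<^sub>R v))"
        using f[OF S[OF s t]] has_derivative_linear by blast
      ultimately show ?thesis
        by (simp add: has_field_derivative_def linear_scale mult_commute_abs)
    qed
    show "((\<lambda>s. f (x + s *\<^sub>R u + h *\<^sub>R v) - f (x + s *\<^sub>R u + 0 *\<^sub>R v)) has_real_derivative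
       (f' (x + s *\<^sub>R u + h *\<^sub>R v) u - f' (x + s *\<^sub>R u + 0 *\<^sub>R v) u)) (at s)"
      by (intro DERIV_diff * ) (use assms(1) in auto)
  qed
  then obtain s where s: "0 < s" "s < h" and eq1:
    "(f (x + h *\<^sub>R u + h *\<^sub>R v) - f (x + h *\<^sub>R u + 0 *\<^sub>R v))
      - (f (x + 0 *\<^sub>R u + h *\<^sub>R v) - f (x + 0 *\<^sub>R u + 0 *\<^sub>R v))
      = (h - 0) * (f' (x + s *\<^sub>R u + h *\<^sub>R v) u - f' (x + s *\<^sub>R u + 0 *\<^sub>R v) u)" by blast
  have "\<exists>t. 0 < t \<and> t < h \<and>
      f' (x + s *\<^sub>R u + h *\<^sub>R v) u - f' (x + s *\<^sub>R u + 0 *\<^sub>R v) u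
      = (h - 0) * f'' (x + s *\<^sub>R u + t *\<^sub>R v) v"
  proof (rule MVT2[OF \<open>h > 0\<close>])
    fix t assume t: "0 \<le> t" "t \<le> h"
    have S': "x + s *\<^sub>R u + t *\<^sub>R v \<in> S" using S s t by auto
    have "((\<lambda>t. x + s *\<^sub>R u + t *\<^sub>R v) has_derivative (\<lambda>r. r *\<^sub>R v)) (at t)"
      by (auto intro!: derivative_eq_intros)
    from diff_chain_at[OF this f'[OF S']]
    have "((\<lambda>t. f' (x + s *\<^sub>R u + t *\<^sub>R v) u) has_derivative (\<lambda>r. f'' (x + s *\<^sub>R u + t *\<^sub>R v) (r *\<^sub>R v))) (at t)"
      by (simp add: o_def)
    moreover have "linear (f'' (x + s *\<^sub>R u + t *\<^sub>R v))"
      using f'[OF S'] has_derivative_linear by blast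
    ultimately show "((\<lambda>t. f' (x + s *\<^sub>R u + t *\<^sub>R v) u) has_real_derivative f'' (x + s *\<^sub>R u + t *\<^sub>R v) v) (at t)"
      by (simp add: has_field_derivative_def linear_scale mult_commute_abs)
  qed
  then obtain t where t: "0 < t" "t < h" and eq2: "f' (x + s *\<^sub>R u + h *\<^sub>R v) u - f' (x + s *\<^sub>R u + 0 *\<^sub>R v) u
      = (h - 0) * f'' (x + s *\<^sub>R u + t *\<^sub>R v) v" by blast
  have "f (x + h *\<^sub>R u + h *\<^sub>R v) - f (x + h *\<^sub>R u) - f (x + h *\<^sub>R v) + f x
      = h * (h * f'' (x + s *\<^sub>R u + t *\<^sub>R v) v)"
    using eq1 eq2 by simp
  with s t show ?thesis by blast
qed

text \<open>The second difference does not change when \<open>u\<close> and \<open>v\<close> are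
  exchanged. It equals h^2 times either mixed derivative at points near \<open>x\<close>, and both
  mixed derivatives are continuous there.\<close>

lemma smooth_on_second_derivative_symmetric_real:
  fixes f :: "'a::real_normed_vector \<Rightarrow> real"
  assumes "open S" "x \<in> S" "smooth_on S f"
  shows "frechet_derivative (\<lambda>y. frechet_derivative f (at y) u) (at x) v =
    frechet_derivative (\<lambda>y. frechet_derivative f (at y) v) (at x) u"
proof -
  define D2 where "D2 u v y = frechet_derivative (\<lambda>y. frechet_derivative f (at y) u) (at y) v" for u v y
  have cont: "isCont (D2 u v) x" for u v
    using smooth_on_imp_continuous_on[OF smooth_on_frechet_derivative[OF smooth_on_frechet_derivative[OF assms(3)]]]
      assms(1,2) unfolding D2_def by (simp add: continuous_on_eq_continuous_at)
  have "\<bar>D2 u v x - D2 v u x\<bar> < e" if "e > 0" for e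
  proof -
    obtain d where d: "d > 0" "ball x d \<subseteq> S" "\<And>y. dist y x < d \<Longrightarrow> \<bar>D2 u v y - D2 u v x\<bar> < e/2"
      "\<And>y. dist y x < d \<Longrightarrow> \<bar>D2 v u y - D2 v u x\<bar> < e/2"
    proof -
      obtain d1 where "d1 > 0" "ball x d1 \<subseteq> S" using assms open_contains_ball by blast
      moreover obtain d2 where "d2 > 0" "\<And>y. dist y x < d2 \<Longrightarrow> \<bar>D2 u v y - D2 u v x\<bar> < e/2"
        using cont[of u v, unfolded continuous_at_eps_delta, rule_format, of "e/2"] \<open>e > 0\<close>
        by (auto simp: dist_real_def)
      moreover obtain d3 where "d3 > 0" "\<And>y. dist y x < d3 \<Longrightarrow> \<bar>D2 v u y - D2 v u x\<bar> < e/2"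
        using cont[of v u, unfolded continuous_at_eps_delta, rule_format, of "e/2"] \<open>e > 0\<close>
        by (auto simp: dist_real_def)
      ultimately show thesis by (intro that[of "min d1 (min d2 d3)"]) auto
    qed
    \<comment> \<open>This keeps the whole parallelogram within distance d/2 of \<open>x\<close>;
      the summand 1 covers the case u = v = 0.\<close>
    define h where "h = d / (2 * (1 + norm u + norm v))"
    have n0: "1 + norm u + norm v > 0" by (smt (verit) norm_ge_zero)
    have h: "h > 0" unfolding h_def using d n0 by simp
    have near: "dist (x + s *\<^sub>R a + t *\<^sub>R b) x < d"
      if "0 \<le> s" "s \<le> h" "0 \<le> t" "t \<le> h" "norm a + norm b = norm u + norm v" for s t a b
    proof -
      have "norm (s *\<^sub>R a + t *\<^sub>R b) \<le> s * norm a + t * norm b"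
        using norm_triangle_ineq[of "s *\<^sub>R a" "t *\<^sub>R b"] that by simp
      also have "\<dots> \<le> h * norm a + h * norm b"
        using that by (intro add_mono mult_right_mono) auto
      also have "\<dots> = h * (norm u + norm v)" using that by (metis distrib_left)
      also have "\<dots> \<le> h * (1 + norm u + norm v)" using h by simp
      also have "\<dots> = d / 2" unfolding h_def using n0 by (simp add: divide_simps)
      also have "\<dots> < d" using d by simp
      finally show ?thesis by (simp add: dist_norm add.assoc)
    qed
    have near': "dist (x + s *\<^sub>R a + t *\<^sub>R b) x < d"
      if "0 < s" "s < h" "0 < t" "t < h" "norm a + norm b = norm u + norm v" for s t a b
      by (intro near) (use that in auto)
    have nS: "y \<in> S" if "dist y x < d" for y
      using d(2) that by (auto simp: dist_commute)
    have ff: "(f has_derivative frechet_derivative f (at y)) (at y)" if "y \<in> S" for y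
      using smooth_on_has_derivative[OF assms(3) that] .
    have ff': "((\<lambda>y. frechet_derivative f (at y) a) has_derivative (\<lambda>b. D2 a b y)) (at y)"
      if "y \<in> S" for y a
      using smooth_on_has_derivative[OF smooth_on_frechet_derivative[OF assms(3)] that, of a]
      unfolding D2_def .
    have mvt: "\<exists>s t. 0 < s \<and> s < h \<and> 0 < t \<and> t < h \<and>
        f (x + h *\<^sub>R a + h *\<^sub>R b) - f (x + h *\<^sub>R a) - f (x + h *\<^sub>R b) + f x
          = h * (h * D2 a b (x + s *\<^sub>R a + t *\<^sub>R b))"
      if "norm a + norm b = norm u + norm v" for a b
      by (rule second_difference_mvt[where S=S, OF h _ ff ff']) (auto intro: nS near that)
    obtain s t where st: "0 < s" "s < h" "0 < t" "t < h" and eq1: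
      "f (x + h *\<^sub>R u + h *\<^sub>R v) - f (x + h *\<^sub>R u) - f (x + h *\<^sub>R v) + f x
        = h * (h * D2 u v (x + s *\<^sub>R u + t *\<^sub>R v))"
      using mvt[of u v] by auto
    obtain s' t' where st': "0 < s'" "s' < h" "0 < t'" "t' < h" and eq2:
      "f (x + h *\<^sub>R v + h *\<^sub>R u) - f (x + h *\<^sub>R v) - f (x + h *\<^sub>R u) + f x
        = h * (h * D2 v u (x + s' *\<^sub>R v + t' *\<^sub>R u))"
      using mvt[of v u] by auto
    have "x + h *\<^sub>R v + h *\<^sub>R u = x + h *\<^sub>R u + h *\<^sub>R v" by (simp add: ac_simps)
    then have "D2 u v (x + s *\<^sub>R u + t *\<^sub>R v) = D2 v u (x + s' *\<^sub>R v + t' *\<^sub>R u)"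
      using eq1 eq2 h by (smt (verit) mult_cancel_left)
    moreover have "\<bar>D2 u v (x + s *\<^sub>R u + t *\<^sub>R v) - D2 u v x\<bar> < e/2"
      by (intro d(3) near' st) simp
    moreover have "\<bar>D2 v u (x + s' *\<^sub>R v + t' *\<^sub>R u) - D2 v u x\<bar> < e/2"
      by (intro d(4) near' st') simp
    ultimately show ?thesis by linarith
  qed
  \<comment> \<open>If the difference were nonzero, taking its absolute value as \<open>e\<close>
    would make it smaller than itself.\<close>
  from this[of "\<bar>D2 u v x - D2 v u x\<bar>"] have "D2 u v x = D2 v u x" by force
  then show ?thesis unfolding D2_def .
qed

lemma smooth_on_second_derivative_symmetric:
  fixes f :: "'a::real_normed_vector \<Rightarrow> 'b::euclidean_space"
  assumes "open S" "x \<in> S" "smooth_on S f"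
  shows "frechet_derivative (\<lambda>y. frechet_derivative f (at y) u) (at x) v =
    frechet_derivative (\<lambda>y. frechet_derivative f (at y) v) (at x) u"
proof (rule euclidean_eqI)
  fix b :: 'b
  let ?g = "\<lambda>y. f y \<bullet> b"
  have g: "smooth_on S ?g"
    using smooth_on_bounded_linear[OF assms(1) bounded_linear_inner_left assms(3)] .
  have D: "frechet_derivative ?g (at y) w = frechet_derivative f (at y) w \<bullet> b" if "y \<in> S" for y w
    by (rule fun_cong[OF frechet_derivative_at[OF bounded_linear.has_derivative[OF
        bounded_linear_inner_left smooth_on_has_derivative[OF assms(3) that]]], symmetric])
  have DD: "frechet_derivative (\<lambda>y. frechet_derivative ?g (at y) w) (at x) z =
      frechet_derivative (\<lambda>y. frechet_derivative f (at y) w) (at x) z \<bullet> b" for w z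
  proof -
    have "((\<lambda>y. frechet_derivative f (at y) w \<bullet> b) has_derivative
       (\<lambda>z. frechet_derivative (\<lambda>y. frechet_derivative f (at y) w) (at x) z \<bullet> b)) (at x)"
      by (rule bounded_linear.has_derivative[OF bounded_linear_inner_left
        smooth_on_has_derivative[OF smooth_on_frechet_derivative[OF assms(3)] assms(2)]])
    then have "((\<lambda>y. frechet_derivative ?g (at y) w) has_derivative
       (\<lambda>z. frechet_derivative (\<lambda>y. frechet_derivative f (at y) w) (at x) z \<bullet> b)) (at x)"
      by (rule has_derivative_transform_within_open[OF _ assms(1,2)]) (simp add: D)
    from fun_cong[OF frechet_derivative_at[OF this]] show ?thesis by simp
  qed
  show "frechet_derivative (\<lambda>y. frechet_derivative f (at y) u) (at x) v \<bullet> b =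
    frechet_derivative (\<lambda>y. frechet_derivative f (at y) v) (at x) u \<bullet> b"
    using smooth_on_second_derivative_symmetric_real[OF assms(1,2) g, of u v] by (simp add: DD)
qed

section \<open>One-forms in charts\<close>

definition local_rep ::
  "('a, 'e::euclidean_space) chart set \<Rightarrow> ('a, 'e) chart \<Rightarrow> ('a \<Rightarrow> 'e covector) \<Rightarrow> 'e \<Rightarrow> 'e \<Rightarrow> real" where
  "local_rep A c \<theta> x v = in_chart A c (\<lambda>q. cov (\<theta> q)) x [v]"

text \<open>The exterior derivative in a chart \<open>c\<close> of free choice, on vectors given by
  their components in \<open>c\<close>. Unlike in \<open>ext_d\<close>, the chart can stay fixed
  while \<open>p\<close> moves.\<close>

definition chart_d ::
  "('a, 'e::euclidean_space) chart set \<Rightarrow> ('a, 'e) chart \<Rightarrow> ('a \<Rightarrow> 'e covector) \<Rightarrow> 'a \<Rightarrow> 'e \<Rightarrow> 'e \<Rightarrow> real" where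
  "chart_d A c \<theta> p u v =
     frechet_derivative (\<lambda>x. local_rep A c \<theta> x v) (at (snd c p)) u
     - frechet_derivative (\<lambda>x. local_rep A c \<theta> x u) (at (snd c p)) v"

lemma d1_eq_chart_d: "d1 A \<theta> p [u, v] = chart_d A (chart_at A p) \<theta> p u v"
  by (simp add: ext_d_def chart_d_def local_rep_def Let_def numeral_2_eq_2 lessThan_Suc)

lemma d1_swap: "d1 A \<theta> p [v, u] = - d1 A \<theta> p [u, v]"
  by (simp add: d1_eq_chart_d chart_d_def)

lemma smooth_1form_iff:
  "smooth_1form A V \<theta> \<longleftrightarrow>
    (\<forall>c\<in>A. \<forall>v. smooth_on (snd c ` (fst c \<inter> V)) (\<lambda>x. local_rep A c \<theta> x v))"
proof -
  have "linear (\<lambda>x. cov (\<theta> p) ([w][0 := x]))" for p w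
    by (simp add: cov_def bounded_linear.linear[OF blinfun.bounded_linear_right])
  then have "alternating_form 1 (cov (\<theta> p))" for p
    by (auto simp: alternating_form_def length_Suc_conv)
  then show ?thesis
    by (auto simp: smooth_form_def local_rep_def length_Suc_conv)
qed

lemma smooth_1formD:
  "smooth_1form A V \<theta> \<Longrightarrow> c \<in> A \<Longrightarrow>
    smooth_on (snd c ` (fst c \<inter> V)) (\<lambda>x. local_rep A c \<theta> x v)"
  unfolding smooth_1form_iff by blast

text \<open>The coordinates of \<open>w\<close> do not depend on \<open>x\<close>, so linearity in
  the second argument survives differentiation in the first. This yields bilinearity of the exterior
  derivative.\<close>

lemma frechet_derivative_linear_family:
  fixes F :: "'x::real_normed_vector \<Rightarrow> 'e::euclidean_space \<Rightarrow> real"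
  assumes "open S" "x0 \<in> S" "\<And>x. x \<in> S \<Longrightarrow> linear (F x)"
    and "\<And>b. (\<lambda>x. F x b) differentiable (at x0)"
  shows "frechet_derivative (\<lambda>x. F x w) (at x0) u
    = (\<Sum>b\<in>Basis. (w \<bullet> b) * frechet_derivative (\<lambda>x. F x b) (at x0) u)"
proof -
  have eq: "(\<Sum>b\<in>Basis. (w \<bullet> b) * F x b) = F x w" if "x \<in> S" for x
  proof -
    have "F x w = F x (\<Sum>b\<in>Basis. (w \<bullet> b) *\<^sub>R b)" by (simp add: euclidean_representation)
    also have "\<dots> = (\<Sum>b\<in>Basis. (w \<bullet> b) * F x b)"
      using assms(3)[OF that] by (simp add: linear_sum linear_scale)
    finally show ?thesis by simp
  qed
  have "((\<lambda>x. \<Sum>b\<in>Basis. (w \<bullet> b) * F x b) has_derivative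
      (\<lambda>u. \<Sum>b\<in>Basis. (w \<bullet> b) * frechet_derivative (\<lambda>x. F x b) (at x0) u)) (at x0)"
    by (intro has_derivative_sum has_derivative_mult_right)
      (use assms(4) in \<open>simp add: frechet_derivative_works[symmetric]\<close>)
  then have "((\<lambda>x. F x w) has_derivative
      (\<lambda>u. \<Sum>b\<in>Basis. (w \<bullet> b) * frechet_derivative (\<lambda>x. F x b) (at x0) u)) (at x0)"
    by (rule has_derivative_transform_within_open[OF _ assms(1,2) eq])
  from fun_cong[OF frechet_derivative_at[OF this], symmetric] show ?thesis .
qed

lemma linear_sum_inner_left_times:
  "linear (\<lambda>w::'e::euclidean_space. \<Sum>b\<in>B. (w \<bullet> b) * (k b :: real))"
  by (rule linearI) (simp_all add: inner_add_left distrib_right sum.distrib sum_distrib_left mult.assoc)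

section \<open>Charts, Jacobians and coordinate invariance of the exterior derivative\<close>

locale manifold =
  fixes X :: "'a topology" and A :: "('a, 'e::euclidean_space) chart set"
  assumes smooth_manifold: "smooth_manifold X A"
begin

lemma
  assumes "c \<in> A"
  shows openin_chart: "openin X (fst c)"
    and open_chart_range: "open (snd c ` fst c)"
    and chart_homeomorphic:
      "homeomorphic_map (subtopology X (fst c)) (top_of_set (snd c ` fst c)) (snd c)"
  using smooth_manifold[unfolded smooth_manifold_def] assms by simp_all

lemma chart_at_mem:
  assumes "p \<in> topspace X"
  shows "chart_at A p \<in> A" "p \<in> fst (chart_at A p)"
proof -
  have "\<exists>c. c \<in> A \<and> p \<in> fst c"
    using assms smooth_manifold unfolding smooth_manifold_def by blast
  then have "chart_at A p \<in> A \<and> p \<in> fst (chart_at A p)"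
    unfolding chart_at_def by (rule someI_ex)
  then show "chart_at A p \<in> A" "p \<in> fst (chart_at A p)" by auto
qed

lemma chart_mem_topspace: "c \<in> A \<Longrightarrow> p \<in> fst c \<Longrightarrow> p \<in> topspace X"
  using openin_chart openin_subset by blast

lemma inj_on_chart: "c \<in> A \<Longrightarrow> inj_on (snd c) (fst c)"
  using homeomorphic_imp_injective_map[OF chart_homeomorphic[of c]]
    openin_subset[OF openin_chart[of c]] by (simp add: Int_absorb1)

lemma chart_inv_chart [simp]: "c \<in> A \<Longrightarrow> p \<in> fst c \<Longrightarrow> chart_inv c (snd c p) = p"
  by (simp add: inj_on_chart)

lemma open_chart_image:
  assumes "c \<in> A" "openin X V"
  shows "open (snd c ` (fst c \<inter> V))"
proof -
  have "openin (subtopology X (fst c)) (fst c \<inter> V)"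
    using assms by (simp add: openin_subtopology_Int2)
  then have "openin (top_of_set (snd c ` fst c)) (snd c ` (fst c \<inter> V))"
    using homeomorphic_imp_open_map[OF chart_homeomorphic[OF assms(1)]] by (simp add: open_map_def)
  then show ?thesis by (simp add: openin_open_eq open_chart_range assms(1))
qed

lemma smooth_on_transition:
  "c \<in> A \<Longrightarrow> c' \<in> A \<Longrightarrow> smooth_on (snd c ` (fst c \<inter> fst c')) (transition c c')"
  using smooth_manifold unfolding smooth_manifold_def by simp

lemma transition_chart: "c \<in> A \<Longrightarrow> p \<in> fst c \<Longrightarrow> transition c c' (snd c p) = snd c' p"
  by (simp add: transition_def)

lemma transition_has_derivative:
  assumes "c \<in> A" "c' \<in> A" "p \<in> fst c" "p \<in> fst c'"
  shows "(transition c c' has_derivative jac c c' p) (at (snd c p))"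
  unfolding jac_def using assms
  by (intro smooth_on_has_derivative[OF smooth_on_transition]) auto

lemma linear_jac:
  "c \<in> A \<Longrightarrow> c' \<in> A \<Longrightarrow> p \<in> fst c \<Longrightarrow> p \<in> fst c' \<Longrightarrow> linear (jac c c' p)"
  by (rule has_derivative_linear[OF transition_has_derivative])

text \<open>Chain rule. The composite of two transition maps is compared with the direct one on the
  triple overlap, an open set around the point.\<close>

lemma jac_jac:
  assumes "c \<in> A" "c' \<in> A" "c'' \<in> A" "p \<in> fst c" "p \<in> fst c'" "p \<in> fst c''"
  shows "jac c' c'' p (jac c c' p v) = jac c c'' p v"
proof -
  let ?S = "snd c ` (fst c \<inter> (fst c' \<inter> fst c''))"
  have "(transition c' c'' has_derivative jac c' c'' p) (at (transition c c' (snd c p)))"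
    using transition_has_derivative[of c' c'' p] assms by (simp add: transition_chart)
  from diff_chain_at[OF transition_has_derivative[of c c' p] this]
  have "(transition c' c'' \<circ> transition c c' has_derivative jac c' c'' p \<circ> jac c c' p) (at (snd c p))"
    using assms by simp
  then have "(transition c c'' has_derivative jac c' c'' p \<circ> jac c c' p) (at (snd c p))"
  proof (rule has_derivative_transform_within_open)
    show "open ?S" by (intro open_chart_image openin_Int openin_chart assms)
    show "snd c p \<in> ?S" using assms by auto
  qed (use assms in \<open>auto simp: transition_chart\<close>)
  from fun_cong[OF frechet_derivative_at[OF this], of v] show ?thesis by (simp add: jac_def)
qed

lemma jac_same:
  assumes "c \<in> A" "p \<in> fst c"
  shows "jac c c p v = v"
proof -
  have "((\<lambda>x. x) has_derivative (\<lambda>x. x)) (at (snd c p))" by (rule has_derivative_ident)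
  then have "(transition c c has_derivative (\<lambda>x. x)) (at (snd c p))"
  proof (rule has_derivative_transform_within_open)
    show "open (snd c ` (fst c \<inter> fst c))" by (intro open_chart_image openin_chart assms)
  qed (use assms in \<open>auto simp: transition_chart\<close>)
  from fun_cong[OF frechet_derivative_at[OF this], of v] show ?thesis by (simp add: jac_def)
qed

lemma jac_inverse:
  "c \<in> A \<Longrightarrow> c' \<in> A \<Longrightarrow> p \<in> fst c \<Longrightarrow> p \<in> fst c' \<Longrightarrow> jac c' c p (jac c c' p v) = v"
  by (simp add: jac_jac jac_same)

lemma local_rep_chart:
  "c \<in> A \<Longrightarrow> p \<in> fst c \<Longrightarrow> local_rep A c \<theta> (snd c p) v = \<theta> p (jac c (chart_at A p) p v)"
  by (simp add: local_rep_def in_chart_def cov_def)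

lemma linear_local_rep:
  assumes "c \<in> A" "x \<in> snd c ` fst c"
  shows "linear (local_rep A c \<theta> x)"
proof -
  obtain p where p: "p \<in> fst c" "x = snd c p" using assms by auto
  have "linear (\<theta> p \<circ> jac c (chart_at A p) p)"
    using chart_at_mem[OF chart_mem_topspace[OF assms(1) p(1)]] assms(1) p(1)
    by (intro linear_compose linear_jac bounded_linear.linear[OF blinfun.bounded_linear_right])
  moreover have "local_rep A c \<theta> x = \<theta> p \<circ> jac c (chart_at A p) p"
    using p assms(1) by (simp add: local_rep_chart fun_eq_iff)
  ultimately show ?thesis by simp
qed

lemma local_rep_jac:
  assumes "c \<in> A" "p \<in> fst c"
  shows "local_rep A c \<theta> (snd c p) (jac (chart_at A p) c p v) = \<theta> p v"
  using assms chart_at_mem[OF chart_mem_topspace[OF assms]] by (simp add: local_rep_chart jac_inverse)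

lemma local_rep_has_derivative:
  assumes "openin X V" "smooth_1form A V \<theta>" "c \<in> A" "p \<in> fst c" "p \<in> V"
  shows "((\<lambda>x. local_rep A c \<theta> x v) has_derivative
    frechet_derivative (\<lambda>x. local_rep A c \<theta> x v) (at (snd c p))) (at (snd c p))"
  by (rule smooth_on_has_derivative[OF smooth_1formD[OF assms(2,3)]]) (use assms in auto)

lemma frechet_derivative_local_rep:
  assumes "openin X V" "smooth_1form A V \<theta>" "c \<in> A" "p \<in> fst c" "p \<in> V"
  shows "frechet_derivative (\<lambda>x. local_rep A c \<theta> x w) (at (snd c p)) u
    = (\<Sum>b\<in>Basis. (w \<bullet> b) * frechet_derivative (\<lambda>x. local_rep A c \<theta> x b) (at (snd c p)) u)"
proof (rule frechet_derivative_linear_family)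
  show "open (snd c ` (fst c \<inter> V))" by (intro open_chart_image assms)
  show "(\<lambda>x. local_rep A c \<theta> x b) differentiable at (snd c p)" for b
    by (rule differentiableI[OF local_rep_has_derivative[OF assms]])
  show "snd c p \<in> snd c ` (fst c \<inter> V)" using assms by simp
  show "linear (local_rep A c \<theta> x)" if "x \<in> snd c ` (fst c \<inter> V)" for x
    using that by (intro linear_local_rep assms) auto
qed

lemma bilinear_chart_d:
  assumes "openin X V" "smooth_1form A V \<theta>" "c \<in> A" "p \<in> fst c" "p \<in> V"
  shows "bilinear (chart_d A c \<theta> p)"
proof -
  define D where "D v = frechet_derivative (\<lambda>x. local_rep A c \<theta> x v) (at (snd c p))" for v
  have 1: "linear (D v)" for v
    unfolding D_def by (rule has_derivative_linear[OF local_rep_has_derivative[OF assms]])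
  have "D w u = (\<Sum>b\<in>Basis. (w \<bullet> b) * D b u)" for w u
    unfolding D_def by (rule frechet_derivative_local_rep[OF assms])
  then have "(\<lambda>w. D w u) = (\<lambda>w. \<Sum>b\<in>Basis. (w \<bullet> b) * D b u)" for u
    by (rule ext)
  then have 2: "linear (\<lambda>w. D w u)" for u
    by (rule ssubst) (rule linear_sum_inner_left_times)
  have "chart_d A c \<theta> p = (\<lambda>u v. D v u - D u v)"
    by (simp add: fun_eq_iff chart_d_def D_def)
  moreover have "linear (\<lambda>v. D v u - D u v)" "linear (\<lambda>u. D v u - D u v)" for u v
    by (rule linear_compose_sub[OF 2 1], rule linear_compose_sub[OF 1 2])
  ultimately show ?thesis by (simp add: bilinear_def)
qed

lemma bilinear_d1:
  assumes "openin X V" "smooth_1form A V \<theta>" "p \<in> V"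
  shows "bilinear (\<lambda>u v. d1 A \<theta> p [u, v])"
proof -
  have "p \<in> topspace X" using assms openin_subset by blast
  from bilinear_chart_d[OF assms(1,2) chart_at_mem[OF this] assms(3)] show ?thesis
    by (simp add: d1_eq_chart_d)
qed

text \<open>The second derivatives of the transition map cancel by symmetry.\<close>

lemma d1_eq_chart_d_jac:
  assumes "openin X V" "smooth_1form A V \<theta>" "c \<in> A" "p \<in> fst c" "p \<in> V"
  shows "d1 A \<theta> p [u, v] =
    chart_d A c \<theta> p (jac (chart_at A p) c p u) (jac (chart_at A p) c p v)"
proof -
  define c' where "c' = chart_at A p"
  define \<phi> where "\<phi> = transition c' c"
  define D where "D y w = frechet_derivative \<phi> (at y) w" for y w
  define D2 where "D2 w = frechet_derivative (\<lambda>y. D y w) (at (snd c' p))" for w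
  define G where "G b = frechet_derivative (\<lambda>x. local_rep A c \<theta> x b) (at (snd c p))" for b
  let ?N = "snd c' ` (fst c' \<inter> (fst c \<inter> V))"
  have c': "c' \<in> A" "p \<in> fst c'"
    using chart_at_mem[OF chart_mem_topspace[OF assms(3,4)]] by (auto simp: c'_def)
  have N: "open ?N" "snd c' p \<in> ?N"
    using assms c' by (auto intro!: open_chart_image openin_Int openin_chart)
  have \<phi>: "smooth_on ?N \<phi>"
    unfolding \<phi>_def by (rule smooth_on_subset[OF smooth_on_transition]) (use assms c' in auto)
  have D0: "D (snd c' p) w = jac c' c p w" for w by (simp add: D_def jac_def \<phi>_def)
  \<comment> \<open>The pullback formula for the coefficients. Expanded in the standard basis it is
    a sum of products, to which the Leibniz rule applies directly.\<close>
  have rep: "local_rep A c' \<theta> y w = (\<Sum>b\<in>Basis. (D y w \<bullet> b) * local_rep A c \<theta> (\<phi> y) b)"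
    if y: "y \<in> ?N" for y w
  proof -
    obtain q where q: "q \<in> fst c'" "q \<in> fst c" "q \<in> V" "y = snd c' q" using y by auto
    have q': "chart_at A q \<in> A" "q \<in> fst (chart_at A q)"
      using chart_at_mem[OF chart_mem_topspace[OF assms(3) q(2)]] by auto
    have \<phi>q: "\<phi> y = snd c q" using q c' by (simp add: \<phi>_def transition_chart)
    have "local_rep A c' \<theta> y w = \<theta> q (jac c' (chart_at A q) q w)"
      using q c' by (simp add: local_rep_chart)
    also have "\<dots> = \<theta> q (jac c (chart_at A q) q (jac c' c q w))"
      using q c' q' assms by (simp add: jac_jac)
    also have "\<dots> = local_rep A c \<theta> (\<phi> y) (D y w)"
      using q assms \<phi>q by (simp add: local_rep_chart D_def jac_def \<phi>_def)
    also have "\<dots> = local_rep A c \<theta> (\<phi> y) (\<Sum>b\<in>Basis. (D y w \<bullet> b) *\<^sub>R b)"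
      by (simp add: euclidean_representation)
    also have "\<dots> = (\<Sum>b\<in>Basis. (D y w \<bullet> b) * local_rep A c \<theta> (\<phi> y) b)"
      using linear_local_rep[of c "\<phi> y" \<theta>] assms q \<phi>q by (simp add: linear_sum linear_scale)
    finally show ?thesis .
  qed
  have D2: "((\<lambda>y. D y w) has_derivative D2 w) (at (snd c' p))" for w
    unfolding D_def D2_def using smooth_on_has_derivative[OF smooth_on_frechet_derivative[OF \<phi>] N(2)] .
  have \<phi>p: "\<phi> (snd c' p) = snd c p" using c' by (simp add: \<phi>_def transition_chart)
  have "(\<phi> has_derivative D (snd c' p)) (at (snd c' p))"
    using smooth_on_has_derivative[OF \<phi> N(2)] by (simp add: D_def[abs_def])
  from diff_chain_at[OF this, of "\<lambda>x. local_rep A c \<theta> x b" "G b" for b]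
  have G: "((\<lambda>y. local_rep A c \<theta> (\<phi> y) b) has_derivative (\<lambda>z. G b (D (snd c' p) z))) (at (snd c' p))" for b
    using local_rep_has_derivative[OF assms, of b] by (simp add: G_def \<phi>p o_def)
  have "((\<lambda>y. \<Sum>b\<in>Basis. (D y w \<bullet> b) * local_rep A c \<theta> (\<phi> y) b) has_derivative
      (\<lambda>z. \<Sum>b\<in>Basis. (D (snd c' p) w \<bullet> b) * G b (D (snd c' p) z)
        + (D2 w z \<bullet> b) * local_rep A c \<theta> (\<phi> (snd c' p)) b)) (at (snd c' p))" for w
    by (intro has_derivative_sum has_derivative_mult G
        bounded_linear.has_derivative[OF bounded_linear_inner_left] D2)
  then have "((\<lambda>y. local_rep A c' \<theta> y w) has_derivative
      (\<lambda>z. \<Sum>b\<in>Basis. (D (snd c' p) w \<bullet> b) * G b (D (snd c' p) z)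
        + (D2 w z \<bullet> b) * local_rep A c \<theta> (\<phi> (snd c' p)) b)) (at (snd c' p))" for w
    by (rule has_derivative_transform_within_open[OF _ N]) (simp add: rep)
  from fun_cong[OF frechet_derivative_at[OF this], symmetric]
  have left: "frechet_derivative (\<lambda>y. local_rep A c' \<theta> y w) (at (snd c' p)) z =
      (\<Sum>b\<in>Basis. (jac c' c p w \<bullet> b) * G b (jac c' c p z))
      + (\<Sum>b\<in>Basis. (D2 w z \<bullet> b) * local_rep A c \<theta> (snd c p) b)" for w z
    by (simp add: sum.distrib D0 \<phi>p)
  have right: "frechet_derivative (\<lambda>x. local_rep A c \<theta> x w) (at (snd c p)) z =
      (\<Sum>b\<in>Basis. (w \<bullet> b) * G b z)" for w z
    unfolding G_def by (rule frechet_derivative_local_rep[OF assms])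
  have "D2 u v = D2 v u"
    unfolding D2_def D_def by (rule smooth_on_second_derivative_symmetric[OF N \<phi>])
  then show ?thesis
    by (simp add: d1_eq_chart_d chart_d_def right flip: c'_def) (simp add: left)
qed

section \<open>Algebra, locality and Leibniz rule for smooth functions and one-forms\<close>

lemma local_rep_scaleR:
  "local_rep A c (\<lambda>q. f q *\<^sub>R \<theta> q) x v = f (chart_inv c x) * local_rep A c \<theta> x v"
  by (simp add: local_rep_def in_chart_def cov_def Let_def scaleR_blinfun.rep_eq)

lemma local_rep_add:
  "local_rep A c (\<lambda>q. \<theta> q + \<eta> q) x v = local_rep A c \<theta> x v + local_rep A c \<eta> x v"
  by (simp add: local_rep_def in_chart_def cov_def Let_def plus_blinfun.rep_eq)

lemma chart_inv_mem: "c \<in> A \<Longrightarrow> x \<in> snd c ` (fst c \<inter> V) \<Longrightarrow> chart_inv c x \<in> V"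
  by auto

lemma smooth_funD: "smooth_fun A V f \<Longrightarrow> c \<in> A \<Longrightarrow>
    smooth_on (snd c ` (fst c \<inter> V)) (\<lambda>x. f (chart_inv c x))"
  by (simp add: smooth_fun_def o_def)

lemma smooth_funI: "(\<And>c. c \<in> A \<Longrightarrow> smooth_on (snd c ` (fst c \<inter> V)) (\<lambda>x. f (chart_inv c x)))
    \<Longrightarrow> smooth_fun A V f"
  by (simp add: smooth_fun_def o_def)

lemma smooth_fun_const: "smooth_fun A V (\<lambda>p. k)"
  by (rule smooth_funI) (intro smooth_on_const)

lemma smooth_fun_add: "openin X V \<Longrightarrow> smooth_fun A V f \<Longrightarrow> smooth_fun A V g \<Longrightarrow>
    smooth_fun A V (\<lambda>p. f p + g p)"
  by (rule smooth_funI) (intro smooth_on_add open_chart_image smooth_funD)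

lemma smooth_fun_diff: "openin X V \<Longrightarrow> smooth_fun A V f \<Longrightarrow> smooth_fun A V g \<Longrightarrow>
    smooth_fun A V (\<lambda>p. f p - g p)"
  by (rule smooth_funI) (intro smooth_on_diff open_chart_image smooth_funD)

lemma smooth_fun_minus: "openin X V \<Longrightarrow> smooth_fun A V f \<Longrightarrow> smooth_fun A V (\<lambda>p. - f p)"
  by (rule smooth_funI) (intro smooth_on_minus open_chart_image smooth_funD)

lemma smooth_fun_mult: "openin X V \<Longrightarrow> smooth_fun A V f \<Longrightarrow> smooth_fun A V g \<Longrightarrow>
    smooth_fun A V (\<lambda>p. f p * g p)"
  by (rule smooth_funI) (intro smooth_on_mult open_chart_image smooth_funD)

lemma smooth_fun_divide:
  assumes "openin X V" "smooth_fun A V f" "smooth_fun A V g" "\<And>p. p \<in> V \<Longrightarrow> g p \<noteq> 0"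
  shows "smooth_fun A V (\<lambda>p. f p / g p)"
  by (rule smooth_funI) (intro smooth_on_divide open_chart_image smooth_funD assms(1-3) assms(4)[OF chart_inv_mem])

lemma smooth_fun_root:
  assumes "openin X V" "smooth_fun A V f" "\<And>p. p \<in> V \<Longrightarrow> f p \<noteq> 0" "odd n"
  shows "smooth_fun A V (\<lambda>p. root n (f p))"
  by (rule smooth_funI) (intro smooth_on_root open_chart_image smooth_funD assms(1,2,4) assms(3)[OF chart_inv_mem])

lemma smooth_fun_subset: "smooth_fun A V f \<Longrightarrow> W \<subseteq> V \<Longrightarrow> smooth_fun A W f"
  by (rule smooth_funI) (rule smooth_on_subset[OF smooth_funD], auto)

text \<open>Continuity of \<open>f\<close> is available only in coordinates, so an open set is
  formed in the range of a chart around \<open>p\<close> and pulled back along the chart. The lemma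
  provides the neighbourhoods on which p3 stays nonzero.\<close>

lemma openin_smooth_fun_nonzero:
  assumes "openin X V" "smooth_fun A V f"
  shows "openin X {p \<in> V. f p \<noteq> 0}"
proof (subst openin_subopen, safe)
  fix p assume p: "p \<in> V" "f p \<noteq> 0"
  have pX: "p \<in> topspace X" using p assms(1) openin_subset by blast
  define c where "c = chart_at A p"
  have c: "c \<in> A" "p \<in> fst c" using chart_at_mem[OF pX] by (auto simp: c_def)
  let ?S = "snd c ` (fst c \<inter> V)" and ?W = "fst c \<inter> V"
  have S: "open ?S" by (rule open_chart_image[OF c(1) assms(1)])
  have "continuous_on ?S (\<lambda>x. f (chart_inv c x))"
    by (rule smooth_on_imp_continuous_on[OF smooth_funD[OF assms(2) c(1)]])
  then have T: "open (?S \<inter> (\<lambda>x. f (chart_inv c x)) -` (- {0}))"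
    using continuous_on_open_vimage[OF S, of "\<lambda>x. f (chart_inv c x)"]
    by (simp add: Int_commute open_Compl)
  have cont: "continuous_map (subtopology X (fst c)) (top_of_set (snd c ` fst c)) (snd c)"
    using chart_homeomorphic[OF c(1)] homeomorphic_imp_continuous_map by blast
  have "openin (top_of_set (snd c ` fst c)) (?S \<inter> (\<lambda>x. f (chart_inv c x)) -` (- {0}))"
    using T open_chart_range[OF c(1)] by (auto simp: openin_open_eq)
  from openin_continuous_map_preimage[OF cont this]
  have "openin (subtopology X (fst c)) {q \<in> topspace (subtopology X (fst c)).
      snd c q \<in> ?S \<inter> (\<lambda>x. f (chart_inv c x)) -` (- {0})}" .
  then have *: "openin X {q \<in> topspace (subtopology X (fst c)).
      snd c q \<in> ?S \<inter> (\<lambda>x. f (chart_inv c x)) -` (- {0})}"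
    using openin_trans_full openin_chart[OF c(1)] by blast
  have eq: "{q \<in> topspace (subtopology X (fst c)).
      snd c q \<in> ?S \<inter> (\<lambda>x. f (chart_inv c x)) -` (- {0})} = {q \<in> ?W. f q \<noteq> 0}"
    using openin_subset[OF openin_chart[OF c(1)]] inj_on_chart[OF c(1)] c(1)
    by (auto dest: inj_onD)
  show "\<exists>T. openin X T \<and> p \<in> T \<and> T \<subseteq> {p \<in> V. f p \<noteq> 0}"
    using * unfolding eq using p c by (intro exI[of _ "{q \<in> ?W. f q \<noteq> 0}"]) auto
qed

lemma smooth_1formI:
  "(\<And>c v. c \<in> A \<Longrightarrow> smooth_on (snd c ` (fst c \<inter> V)) (\<lambda>x. local_rep A c \<theta> x v))
    \<Longrightarrow> smooth_1form A V \<theta>"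
  unfolding smooth_1form_iff by simp

lemma smooth_1form_scaleR:
  assumes "openin X V" "smooth_fun A V f" "smooth_1form A V \<theta>"
  shows "smooth_1form A V (\<lambda>p. f p *\<^sub>R \<theta> p)"
  by (intro smooth_1formI, unfold local_rep_scaleR)
    (intro smooth_on_mult open_chart_image smooth_funD smooth_1formD assms)

lemma smooth_1form_add:
  assumes "openin X V" "smooth_1form A V \<theta>" "smooth_1form A V \<eta>"
  shows "smooth_1form A V (\<lambda>p. \<theta> p + \<eta> p)"
  by (intro smooth_1formI, unfold local_rep_add)
    (intro smooth_on_add open_chart_image smooth_1formD assms)

lemma smooth_1form_subset: "smooth_1form A V \<theta> \<Longrightarrow> W \<subseteq> V \<Longrightarrow> smooth_1form A W \<theta>"
  by (intro smooth_1formI) (rule smooth_on_subset[OF smooth_1formD], auto)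

lemma local_rep_cong:
  "chart_inv c x = q \<Longrightarrow> \<theta> q = \<eta> q \<Longrightarrow> local_rep A c \<theta> x v = local_rep A c \<eta> x v"
  by (simp add: local_rep_def in_chart_def cov_def Let_def)

lemma smooth_1form_cong:
  assumes "openin X V" "smooth_1form A V \<theta>" "\<And>p. p \<in> V \<Longrightarrow> \<theta> p = \<eta> p"
  shows "smooth_1form A V \<eta>"
proof (rule smooth_1formI)
  fix c v assume c: "c \<in> A"
  show "smooth_on (snd c ` (fst c \<inter> V)) (\<lambda>x. local_rep A c \<eta> x v)"
    by (rule smooth_on_cong[OF open_chart_image[OF c assms(1)] local_rep_cong[OF refl]
          smooth_1formD[OF assms(2) c]])
      (auto simp: assms(3) c)
qed

lemma smooth_1form_local:
  assumes "\<And>p. p \<in> V \<Longrightarrow> \<exists>W. openin X W \<and> p \<in> W \<and> smooth_1form A W \<theta>"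
  shows "smooth_1form A V \<theta>"
proof (rule smooth_1formI, rule smooth_on_local)
  fix c v x assume c: "c \<in> A" and "x \<in> snd c ` (fst c \<inter> V)"
  then obtain p where p: "p \<in> fst c" "p \<in> V" "x = snd c p" by auto
  from assms[OF p(2)] obtain W where W: "openin X W" "p \<in> W" "smooth_1form A W \<theta>" by blast
  then show "\<exists>T. open T \<and> x \<in> T \<and> smooth_on T (\<lambda>x. local_rep A c \<theta> x v)"
    using p by (intro exI[of _ "snd c ` (fst c \<inter> W)"] conjI open_chart_image smooth_1formD c) auto
qed

text \<open>The differential at \<open>p\<close> depends on the germ of the form, hence agreement is
  required on an open set around \<open>p\<close>. Gluing and the second half of uniqueness rest on
  this.\<close>

lemma d1_cong:
  assumes "openin X V" "smooth_1form A V \<theta>" "\<And>q. q \<in> V \<Longrightarrow> \<theta> q = \<eta> q" "p \<in> V"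
  shows "d1 A \<eta> p [u, v] = d1 A \<theta> p [u, v]"
proof -
  define c where "c = chart_at A p"
  have pX: "p \<in> topspace X" using assms(1,4) openin_subset by blast
  have c: "c \<in> A" "p \<in> fst c" using chart_at_mem[OF pX] by (auto simp: c_def)
  have "frechet_derivative (\<lambda>x. local_rep A c \<eta> x w) (at (snd c p))
      = frechet_derivative (\<lambda>x. local_rep A c \<theta> x w) (at (snd c p))" for w
  proof (rule frechet_derivative_at[symmetric], rule has_derivative_transform_within_open)
    show "((\<lambda>x. local_rep A c \<theta> x w) has_derivative
        frechet_derivative (\<lambda>x. local_rep A c \<theta> x w) (at (snd c p))) (at (snd c p))"
      by (rule local_rep_has_derivative[OF assms(1,2) c assms(4)])
    show "open (snd c ` (fst c \<inter> V))" by (rule open_chart_image[OF c(1) assms(1)])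
    show "snd c p \<in> snd c ` (fst c \<inter> V)" using c assms(4) by simp
    show "local_rep A c \<theta> x w = local_rep A c \<eta> x w" if "x \<in> snd c ` (fst c \<inter> V)" for x
      by (rule local_rep_cong[OF refl]) (use that c(1) assms(3) in auto)
  qed
  then show ?thesis by (simp add: d1_eq_chart_d chart_d_def flip: c_def)
qed

lemma d1_add:
  assumes "openin X V" "smooth_1form A V \<theta>" "smooth_1form A V \<eta>" "p \<in> V"
  shows "d1 A (\<lambda>q. \<theta> q + \<eta> q) p [u, v] = d1 A \<theta> p [u, v] + d1 A \<eta> p [u, v]"
proof -
  have "p \<in> topspace X" using assms(1,4) openin_subset by blast
  note c = chart_at_mem[OF this]
  have "frechet_derivative (\<lambda>x. local_rep A (chart_at A p) \<theta> x w + local_rep A (chart_at A p) \<eta> x w)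
      (at (snd (chart_at A p) p)) z
    = frechet_derivative (\<lambda>x. local_rep A (chart_at A p) \<theta> x w) (at (snd (chart_at A p) p)) z
      + frechet_derivative (\<lambda>x. local_rep A (chart_at A p) \<eta> x w) (at (snd (chart_at A p) p)) z" for w z
    by (rule fun_cong[OF frechet_derivative_at[OF has_derivative_add[OF
        local_rep_has_derivative[OF assms(1,2) c assms(4)]
        local_rep_has_derivative[OF assms(1,3) c assms(4)]]], symmetric])
  then show ?thesis by (simp add: d1_eq_chart_d chart_d_def local_rep_add)
qed

text \<open>Leibniz rule with \<gamma> = df. The form of \<gamma> is left open because later
  arguments only use that the correction vanishes where \<theta> does.\<close>

lemma d1_scaleR:
  assumes "openin X V" "smooth_fun A V f" "smooth_1form A V \<theta>" "p \<in> V"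
  obtains \<gamma> where "\<And>u v. d1 A (\<lambda>q. f q *\<^sub>R \<theta> q) p [u, v] =
    f p * d1 A \<theta> p [u, v] + (\<gamma> u * \<theta> p v - \<gamma> v * \<theta> p u)"
proof -
  define c where "c = chart_at A p"
  have pX: "p \<in> topspace X" using assms(1,4) openin_subset by blast
  have c: "c \<in> A" "p \<in> fst c" using chart_at_mem[OF pX] by (auto simp: c_def)
  define \<gamma> where "\<gamma> = frechet_derivative (\<lambda>x. f (chart_inv c x)) (at (snd c p))"
  have f: "((\<lambda>x. f (chart_inv c x)) has_derivative \<gamma>) (at (snd c p))"
    unfolding \<gamma>_def by (rule smooth_on_has_derivative[OF smooth_funD[OF assms(2) c(1)]])
      (use c assms(4) in simp)
  have rep: "local_rep A c \<theta> (snd c p) w = \<theta> p w" for w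
    using c by (simp add: local_rep_chart jac_same flip: c_def)
  have "frechet_derivative (\<lambda>x. f (chart_inv c x) * local_rep A c \<theta> x w) (at (snd c p)) z
    = f p * frechet_derivative (\<lambda>x. local_rep A c \<theta> x w) (at (snd c p)) z + \<gamma> z * \<theta> p w" for w z
    using fun_cong[OF frechet_derivative_at[OF has_derivative_mult[OF f
        local_rep_has_derivative[OF assms(1,3) c assms(4)]]], symmetric, of w z] c
    by (simp add: rep)
  then show thesis
    by (intro that[of \<gamma>])
      (simp add: d1_eq_chart_d chart_d_def local_rep_scaleR algebra_simps flip: c_def)
qed

section \<open>Evaluation of forms on smooth vector fields\<close>

lemma smooth_fun_apply_vector_field:
  assumes "openin X V" "smooth_1form A V \<theta>" "smooth_vector_field A V Y"
  shows "smooth_fun A V (\<lambda>p. \<theta> p (Y p))"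
proof (rule smooth_funI)
  fix c assume c: "c \<in> A"
  let ?S = "snd c ` (fst c \<inter> V)"
  let ?Y = "\<lambda>x. let p = chart_inv c x in jac (chart_at A p) c p (Y p)"
  have S: "open ?S" by (rule open_chart_image[OF c assms(1)])
  have Y: "smooth_on ?S ?Y" using assms(3) c unfolding smooth_vector_field_def by blast
  have "smooth_on ?S (\<lambda>x. \<Sum>b\<in>Basis. (?Y x \<bullet> b) * local_rep A c \<theta> x b)"
    by (intro smooth_on_sum smooth_on_mult S smooth_1formD[OF assms(2) c]
        smooth_on_bounded_linear[OF S bounded_linear_inner_left Y])
  then show "smooth_on ?S (\<lambda>x. \<theta> (chart_inv c x) (Y (chart_inv c x)))"
  proof (rule smooth_on_cong[OF S, rotated])
    fix x assume "x \<in> ?S"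
    then obtain p where p: "p \<in> fst c" "p \<in> V" "x = snd c p" by auto
    have "(\<Sum>b\<in>Basis. (?Y x \<bullet> b) * local_rep A c \<theta> x b)
        = local_rep A c \<theta> x (\<Sum>b\<in>Basis. (?Y x \<bullet> b) *\<^sub>R b)"
      using linear_local_rep[OF c, of x \<theta>] p by (simp add: linear_sum linear_scale)
    also have "\<dots> = local_rep A c \<theta> x (?Y x)" by (simp only: euclidean_representation)
    also have "\<dots> = \<theta> (chart_inv c x) (Y (chart_inv c x))"
      using p c by (simp add: local_rep_jac)
    finally show "(\<Sum>b\<in>Basis. (?Y x \<bullet> b) * local_rep A c \<theta> x b)
        = \<theta> (chart_inv c x) (Y (chart_inv c x))" .
  qed
qed

text \<open>Coordinate invariance replaces the varying chart \<open>chart_at A p\<close> by the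
  fixed chart \<open>c\<close>. There the value is a polynomial in the components of the fields and
  first partial derivatives of the coefficients of \<theta>.\<close>

lemma smooth_fun_d1_vector_fields:
  assumes "openin X V" "smooth_1form A V \<theta>" "smooth_vector_field A V Y" "smooth_vector_field A V Z"
  shows "smooth_fun A V (\<lambda>p. d1 A \<theta> p [Y p, Z p])"
proof (rule smooth_funI)
  fix c assume c: "c \<in> A"
  let ?S = "snd c ` (fst c \<inter> V)"
  define Y' where "Y' x = (let p = chart_inv c x in jac (chart_at A p) c p (Y p))" for x
  define Z' where "Z' x = (let p = chart_inv c x in jac (chart_at A p) c p (Z p))" for x
  define F where "F x b b' = frechet_derivative (\<lambda>x. local_rep A c \<theta> x b') (at x) b
    - frechet_derivative (\<lambda>x. local_rep A c \<theta> x b) (at x) b'" for x b b'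
  have S: "open ?S" by (rule open_chart_image[OF c assms(1)])
  have Y': "smooth_on ?S Y'" using assms(3) c unfolding smooth_vector_field_def Y'_def by blast
  have Z': "smooth_on ?S Z'" using assms(4) c unfolding smooth_vector_field_def Z'_def by blast
  have F: "smooth_on ?S (\<lambda>x. F x b b')" for b b'
    unfolding F_def
    by (intro smooth_on_diff S smooth_on_frechet_derivative smooth_1formD[OF assms(2) c])
  have "smooth_on ?S (\<lambda>x. \<Sum>b\<in>Basis. \<Sum>b'\<in>Basis. ((Y' x \<bullet> b) * (Z' x \<bullet> b')) * F x b b')"
    by (intro smooth_on_sum smooth_on_mult S F
        smooth_on_bounded_linear[OF S bounded_linear_inner_left Y']
        smooth_on_bounded_linear[OF S bounded_linear_inner_left Z'])
  then show "smooth_on ?S (\<lambda>x. d1 A \<theta> (chart_inv c x) [Y (chart_inv c x), Z (chart_inv c x)])"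
  proof (rule smooth_on_cong[OF S, rotated])
    fix x assume "x \<in> ?S"
    then obtain p where p: "p \<in> fst c" "p \<in> V" "x = snd c p" by auto
    have bil: "bilinear (chart_d A c \<theta> p)"
      by (rule bilinear_chart_d[OF assms(1,2) c p(1,2)])
    have "d1 A \<theta> p [Y p, Z p] = chart_d A c \<theta> p (Y' x) (Z' x)"
      using d1_eq_chart_d_jac[OF assms(1,2) c p(1,2)] p c by (simp add: Y'_def Z'_def)
    also have "\<dots> = chart_d A c \<theta> p (\<Sum>b\<in>Basis. (Y' x \<bullet> b) *\<^sub>R b) (\<Sum>b\<in>Basis. (Z' x \<bullet> b) *\<^sub>R b)"
      by (simp only: euclidean_representation)
    also have "\<dots> = (\<Sum>b\<in>Basis. \<Sum>b'\<in>Basis. ((Y' x \<bullet> b) * (Z' x \<bullet> b')) * chart_d A c \<theta> p b b')"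
      by (simp add: bilinear_sum[OF bil] sum.cartesian_product bilinear_lmul[OF bil]
          bilinear_rmul[OF bil] mult.assoc mult.left_commute)
    also have "\<dots> = (\<Sum>b\<in>Basis. \<Sum>b'\<in>Basis. ((Y' x \<bullet> b) * (Z' x \<bullet> b')) * F x b b')"
      by (simp add: chart_d_def F_def p(3))
    finally show "(\<Sum>b\<in>Basis. \<Sum>b'\<in>Basis. ((Y' x \<bullet> b) * (Z' x \<bullet> b')) * F x b b')
        = d1 A \<theta> (chart_inv c x) [Y (chart_inv c x), Z (chart_inv c x)]"
      using p c by simp
  qed
qed

end

section \<open>Dual frames\<close>

lemma atLeastAtMost_1_4: "{1..4::nat} = {1, 2, 3, 4}"
  by auto

text \<open>Coframings are indexed by the naturals 1 to 4, matrices by the type \<open>4\<close>, in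
  which the numeral 4 is 0. This bijection mediates between them.\<close>

definition idx4 :: "4 \<Rightarrow> nat" where
  "idx4 i = (if i = 1 then 1 else if i = 2 then 2 else if i = 3 then 3 else 4)"

lemma bij_betw_idx4: "bij_betw idx4 UNIV {1..4}"
proof -
  have "inj idx4"
    unfolding inj_def by (simp add: forall_4 idx4_def)
  moreover have "range idx4 = {1..4}"
    unfolding UNIV_4 atLeastAtMost_1_4 by (auto simp: idx4_def)
  ultimately show ?thesis by (simp add: bij_betw_def)
qed

lemma sum_idx4: "(\<Sum>i\<in>UNIV. f (idx4 i)) = (\<Sum>i=1..4. f i)"
  by (rule sum.reindex_bij_betw[OF bij_betw_idx4])

lemma inj_idx4: "inj idx4"
  using bij_betw_idx4 by (simp add: bij_betw_def)

lemma idx4_mem: "idx4 i \<in> {1..4}"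
  using bij_betw_idx4 by (auto simp: bij_betw_def)

definition dual_frame :: "(nat \<Rightarrow> (real^4) covector) \<Rightarrow> (nat \<Rightarrow> real^4) \<Rightarrow> bool" where
  "dual_frame w E \<longleftrightarrow> (\<forall>i\<in>{1..4}. \<forall>j\<in>{1..4}. w i (E j) = (if i = j then 1 else 0))"

lemma dual_frameD:
  assumes "dual_frame w E"
  shows "w 1 (E 1) = 1" "w 1 (E 2) = 0" "w 1 (E 3) = 0" "w 1 (E 4) = 0"
    "w 2 (E 1) = 0" "w 2 (E 2) = 1" "w 2 (E 3) = 0" "w 2 (E 4) = 0"
    "w 3 (E 1) = 0" "w 3 (E 2) = 0" "w 3 (E 3) = 1" "w 3 (E 4) = 0"
    "w 4 (E 1) = 0" "w 4 (E 2) = 0" "w 4 (E 3) = 0" "w 4 (E 4) = 1"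
  using assms unfolding dual_frame_def atLeastAtMost_1_4 by simp_all

definition coframe_matrix :: "(nat \<Rightarrow> (real^4) \<Rightarrow> real) \<Rightarrow> real^4^4" where
  "coframe_matrix w = (\<chi> i k. w (idx4 i) (axis k 1))"

lemma coframe_matrix_mult_vector:
  assumes "\<And>i. linear (w i)"
  shows "(coframe_matrix w *v x) $ i = w (idx4 i) x"
proof -
  have "w (idx4 i) x = w (idx4 i) (\<Sum>k\<in>UNIV. x $ k *\<^sub>R axis k 1)"
    by (simp add: basis_expansion flip: scalar_mult_eq_scaleR)
  also have "\<dots> = (\<Sum>k\<in>UNIV. x $ k * w (idx4 i) (axis k 1))"
    using assms by (simp add: linear_sum linear_scale)
  finally show ?thesis
    by (simp add: matrix_vector_mult_def coframe_matrix_def mult.commute)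
qed

text \<open>The covectors are the rows of a square matrix. Independent rows give a right inverse,
  whose columns are the dual vectors.\<close>

lemma dual_frame_exists:
  assumes "inj_on w {1..4}" "independent (w ` {1..4})"
  shows "\<exists>E. dual_frame w E"
proof -
  let ?M = "coframe_matrix (\<lambda>i. blinfun_apply (w i))"
  have M: "(?M *v x) $ i = w (idx4 i) x" for x i
    by (rule coframe_matrix_mult_vector) (rule bounded_linear.linear[OF blinfun.bounded_linear_right])
  have "\<exists>B. ?M ** B = mat 1"
    unfolding matrix_right_invertible_independent_rows
  proof (intro allI impI)
    fix c :: "4 \<Rightarrow> real" and i
    assume c: "(\<Sum>i\<in>UNIV. c i *s row i ?M) = 0"
    have "(\<Sum>i\<in>UNIV. c i *\<^sub>R w (idx4 i)) v = 0" for v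
    proof -
      have "(\<Sum>i\<in>UNIV. c i *\<^sub>R w (idx4 i)) v = (\<Sum>i\<in>UNIV. c i * (?M *v v) $ i)"
        by (simp add: blinfun.sum_left blinfun.scaleR_left M)
      also have "\<dots> = (\<Sum>k\<in>UNIV. (\<Sum>i\<in>UNIV. c i *s row i ?M) $ k * v $ k)"
        by (simp add: matrix_vector_mult_def row_def sum_distrib_left sum_distrib_right mult.assoc)
          (rule sum.swap)
      finally show ?thesis by (simp add: c)
    qed
    then have 0: "(\<Sum>i\<in>UNIV. c i *\<^sub>R w (idx4 i)) = 0" by (simp add: blinfun_eqI)
    \<comment> \<open>Independence of a set speaks of coefficients attached to covectors;
      \<open>g\<close> recovers the index of a covector, so that \<open>c\<close> can be
      transported.\<close>
    define g where "g = inv_into UNIV (w \<circ> idx4)"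
    have inj: "inj (w \<circ> idx4)"
      using comp_inj_on[OF inj_idx4] assms(1) bij_betw_idx4 by (simp add: bij_betw_def)
    have g: "g (w (idx4 i)) = i" for i
      using inv_into_f_f[OF inj, of i] by (simp add: g_def)
    have img: "w ` {1..4} = range (w \<circ> idx4)"
      using bij_betw_idx4 by (metis bij_betw_def image_comp)
    have "(\<Sum>v\<in>range (w \<circ> idx4). c (g v) *\<^sub>R v) = 0"
      by (subst sum.reindex[OF inj]) (simp add: g 0)
    moreover have "finite (range (w \<circ> idx4))" by simp
    ultimately have "c (g v) = 0" if "v \<in> range (w \<circ> idx4)" for v
      using assms(2) that unfolding img by (auto simp: dependent_finite)
    from this[of "w (idx4 i)"] show "c i = 0" by (simp add: g)
  qed
  then obtain B where B: "?M ** B = mat 1" by blast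
  define E where "E j = (\<chi> k. B $ k $ (inv_into UNIV idx4 j))" for j
  have E: "E (idx4 j) = column j B" for j
    by (simp add: E_def column_def inj_idx4)
  have "w (idx4 i) (E (idx4 j)) = (if idx4 i = idx4 j then 1 else 0)" for i j
  proof -
    have "w (idx4 i) (E (idx4 j)) = (?M *v column j B) $ i" by (simp add: M E)
    also have "\<dots> = (?M ** B) $ i $ j"
      by (simp add: matrix_vector_mult_def matrix_matrix_mult_def column_def)
    finally show ?thesis using B inj_idx4 by (simp add: mat_def inj_eq)
  qed
  then have "w i (E j) = (if i = j then 1 else 0)" if "i \<in> range idx4" "j \<in> range idx4" for i j
    using that by (elim rangeE) simp
  moreover have "range idx4 = {1..4}" using bij_betw_idx4 by (simp add: bij_betw_def)
  ultimately have "dual_frame w E" by (simp add: dual_frame_def del: One_nat_def)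
  then show ?thesis by blast
qed

text \<open>Evaluating a vanishing combination at \<open>E j\<close> isolates its coefficient. A new
  coframing can thus be verified by sixteen evaluations on a proposed dual frame.\<close>

lemma dual_frame_imp_independent:
  assumes "dual_frame w E"
  shows "inj_on w {1..4}" "independent (w ` {1..4})"
proof -
  show inj: "inj_on w {1..4}"
  proof (rule inj_onI)
    fix i j assume ij: "i \<in> {1..4}" "j \<in> {1..4}" "w i = w j"
    have "w j (E j) = 1" "w i (E j) = (if i = j then 1 else 0)"
      using assms ij(1,2) by (simp_all add: dual_frame_def del: One_nat_def)
    then show "i = j" using ij(3) by (simp split: if_splits)
  qed
  show "independent (w ` {1..4})"
  proof (rule independent_if_scalars_zero)
    fix u x assume u: "(\<Sum>x\<in>w ` {1..4}. u x *\<^sub>R x) = 0" and "x \<in> w ` {1..4}"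
    then obtain j where j: "j \<in> {1..4}" "x = w j" by auto
    have "0 = (\<Sum>x\<in>w ` {1..4}. u x *\<^sub>R x) (E j)" by (simp only: u blinfun.zero_left)
    also have "\<dots> = (\<Sum>i\<in>{1..4}. u (w i) * w i (E j))"
      by (simp add: sum.reindex[OF inj] blinfun.sum_left blinfun.scaleR_left del: One_nat_def)
    also have "\<dots> = (\<Sum>i\<in>{1..4}. if j = i then u (w i) else 0)"
      by (rule sum.cong) (use assms j in \<open>auto simp: dual_frame_def simp del: One_nat_def\<close>)
    also have "\<dots> = u (w j)" using j(1) by (simp only: sum.delta' finite_atLeastAtMost if_True)
    finally show "u x = 0" using j by simp
  qed simp
qed

text \<open>Duality says that the matrix of the \<open>E j\<close> is a right inverse of that of the
  \<open>w i\<close>. For square matrices it is then a left inverse too, which is the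
  expansion.\<close>

lemma dual_frame_expand:
  assumes "dual_frame w E"
  shows "v = w 1 v *\<^sub>R E 1 + w 2 v *\<^sub>R E 2 + w 3 v *\<^sub>R E 3 + w 4 v *\<^sub>R E 4"
proof -
  let ?M = "coframe_matrix (\<lambda>i. blinfun_apply (w i))"
  define B :: "real^4^4" where "B = (\<chi> k j. E (idx4 j) $ k)"
  have M: "(?M *v x) $ i = w (idx4 i) x" for x i
    by (rule coframe_matrix_mult_vector) (rule bounded_linear.linear[OF blinfun.bounded_linear_right])
  have "(?M ** B) $ i $ j = mat 1 $ i $ j" for i j
  proof -
    have "(?M ** B) $ i $ j = (?M *v E (idx4 j)) $ i"
      by (simp add: matrix_vector_mult_def matrix_matrix_mult_def B_def)
    also have "\<dots> = (if idx4 i = idx4 j then 1 else 0)"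
      using assms idx4_mem unfolding M dual_frame_def by blast
    finally show ?thesis using inj_idx4 by (simp add: mat_def inj_eq)
  qed
  then have "?M ** B = mat 1" by (simp add: vec_eq_iff)
  then have "B ** ?M = mat 1" by (simp add: matrix_left_right_inverse)
  then have "v = B *v (?M *v v)" by (simp add: matrix_vector_mul_assoc)
  moreover have "(B *v (?M *v v)) $ k = (\<Sum>j\<in>UNIV. B $ k $ j * (?M *v v) $ j)" for k
    by (simp add: matrix_vector_mult_def)
  ultimately have "v $ k = (\<Sum>j\<in>UNIV. B $ k $ j * (?M *v v) $ j)" for k
    by presburger
  then have v: "v $ k = (\<Sum>j\<in>UNIV. E (idx4 j) $ k * w (idx4 j) v)" for k
    by (simp only: M) (simp add: B_def)
  have "v $ k = (w 1 v *\<^sub>R E 1 + w 2 v *\<^sub>R E 2 + w 3 v *\<^sub>R E 3 + w 4 v *\<^sub>R E 4) $ k" for k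
    using v[of k] unfolding sum_idx4[of "\<lambda>j. E j $ k * w j v"] atLeastAtMost_1_4
    by (simp add: mult.commute)
  then show ?thesis by (simp add: vec_eq_iff)
qed

lemma dual_frame_covector_eqI:
  assumes "dual_frame w E" "\<And>j. j \<in> {1..4} \<Longrightarrow> blinfun_apply \<alpha> (E j) = blinfun_apply \<beta> (E j)"
  shows "\<alpha> = \<beta>"
proof (rule blinfun_eqI)
  fix v
  show "\<alpha> v = \<beta> v"
    by (subst (1 2) dual_frame_expand[OF assms(1), of v])
      (use assms(2)[of 1] assms(2)[of 2] assms(2)[of 3] assms(2)[of 4] in
        \<open>simp add: blinfun.add_right blinfun.scaleR_right\<close>)
qed

text \<open>The index pairs are ordered as in the wedge products of the structure equations, so
  coefficients can be read off without sign changes.\<close>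

lemma bilinear_alternating_expand:
  fixes B :: "real^4 \<Rightarrow> real^4 \<Rightarrow> real"
  assumes "dual_frame w E" "bilinear B" "\<And>u v. B v u = - B u v"
  shows "B u v =
    B (E 2) (E 1) * (w 2 u * w 1 v - w 2 v * w 1 u) + B (E 3) (E 1) * (w 3 u * w 1 v - w 3 v * w 1 u)
    + B (E 4) (E 1) * (w 4 u * w 1 v - w 4 v * w 1 u) + B (E 3) (E 2) * (w 3 u * w 2 v - w 3 v * w 2 u)
    + B (E 4) (E 2) * (w 4 u * w 2 v - w 4 v * w 2 u) + B (E 3) (E 4) * (w 3 u * w 4 v - w 3 v * w 4 u)"
proof -
  have 0: "B x x = 0" for x using assms(3)[of x x] by simp
  have "B u v = B (w 1 u *\<^sub>R E 1 + w 2 u *\<^sub>R E 2 + w 3 u *\<^sub>R E 3 + w 4 u *\<^sub>R E 4)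
      (w 1 v *\<^sub>R E 1 + w 2 v *\<^sub>R E 2 + w 3 v *\<^sub>R E 3 + w 4 v *\<^sub>R E 4)"
    by (simp only: dual_frame_expand[OF assms(1), symmetric])
  then show ?thesis
    by (simp add: bilinear_ladd[OF assms(2)] bilinear_radd[OF assms(2)] bilinear_lmul[OF assms(2)]
        bilinear_rmul[OF assms(2)] 0 assms(3)[of "E 2" "E 1"] assms(3)[of "E 3" "E 1"]
        assms(3)[of "E 4" "E 1"] assms(3)[of "E 3" "E 2"] assms(3)[of "E 4" "E 2"]
        assms(3)[of "E 3" "E 4"] algebra_simps del: One_nat_def)
qed

lemma span_pair: "x \<in> span {a, b} \<longleftrightarrow> (\<exists>s t. x = s *\<^sub>R a + t *\<^sub>R b)" for a b :: "'v::real_vector"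
  by (auto simp: span_insert span_singleton algebra_simps)

text \<open>This is why changes \<open>\<omega> 1\<close> to a \<open>\<omega> 1\<close> and
  \<open>\<omega> 2\<close> to b \<open>\<omega> 2\<close> + c \<open>\<omega> 1\<close> preserve
  the system I.\<close>

lemma span_lower_triangular:
  fixes x y :: "'v::real_vector"
  assumes "a \<noteq> 0" "b \<noteq> 0"
  shows "span {a *\<^sub>R x, b *\<^sub>R y + c *\<^sub>R x} = span {x, y}"
proof (rule span_eq[THEN iffD2], intro conjI subsetI)
  fix z assume "z \<in> {a *\<^sub>R x, b *\<^sub>R y + c *\<^sub>R x}"
  then show "z \<in> span {x, y}"
    by (elim insertE) (simp_all add: span_add span_scale span_base)
next
  fix z assume z: "z \<in> {x, y}"
  let ?S = "span {a *\<^sub>R x, b *\<^sub>R y + c *\<^sub>R x}"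
  have "(1 / a) *\<^sub>R (a *\<^sub>R x) \<in> ?S" by (intro span_scale span_base) simp
  then have x: "x \<in> ?S" using assms by simp
  have "(1 / b) *\<^sub>R ((b *\<^sub>R y + c *\<^sub>R x) - c *\<^sub>R x) \<in> ?S"
    by (intro span_scale span_diff span_base x) simp
  then have "y \<in> ?S" using assms by simp
  with x z show "z \<in> ?S" by auto
qed

lemma span_scaleR_singleton: "a \<noteq> 0 \<Longrightarrow> span {a *\<^sub>R x} = span {x}" for x :: "'v::real_vector"
  using span_lower_triangular[of a 1 x 0 0] by (simp add: insert_commute[of _ 0])

locale manifold4 = manifold X A for X :: "'a topology" and A :: "('a, real^4) chart set"
begin

lemma coframing_dual_exists:
  assumes "coframing A V \<omega>"
  obtains E where "\<And>p. p \<in> V \<Longrightarrow> dual_frame (\<lambda>i. \<omega> i p) (E p)"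
proof -
  have "\<forall>p\<in>V. \<exists>E. dual_frame (\<lambda>i. \<omega> i p) E"
    using assms dual_frame_exists unfolding coframing_def by blast
  then show thesis using that by metis
qed

text \<open>Smoothness by Cramer's rule in a chart.\<close>

lemma dual_frame_smooth:
  assumes "openin X V" "\<And>i. i \<in> {1..4} \<Longrightarrow> smooth_1form A V (\<omega> i)"
    and "\<And>p. p \<in> V \<Longrightarrow> dual_frame (\<lambda>i. \<omega> i p) (E p)" "j \<in> {1..4}"
  shows "smooth_vector_field A V (\<lambda>p. E p j)"
  unfolding smooth_vector_field_def
proof (rule ballI)
  fix c assume c: "c \<in> A"
  let ?S = "snd c ` (fst c \<inter> V)"
  let ?Y = "\<lambda>j x. let p = chart_inv c x in jac (chart_at A p) c p (E p j)"
  define M where "M x = coframe_matrix (\<lambda>i. local_rep A c (\<omega> i) x)" for x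
  \<comment> \<open>In the chart \<open>c\<close>, the components of \<open>E p j\<close> solve the
    linear system with matrix \<open>M x\<close> and right side \<open>y\<close>;
    \<open>N k x\<close> is the numerator matrix of Cramer's rule, with column \<open>k\<close>
    replaced.\<close>
  define y :: "real^4" where "y = (\<chi> i. if idx4 i = j then 1 else 0)"
  define N where "N k x = (\<chi> i l. if l = k then y $ i else M x $ i $ l)" for k x
  have S: "open ?S" by (rule open_chart_image[OF c assms(1)])
  have lin: "linear (local_rep A c (\<omega> i) x)" if "x \<in> ?S" for i x
    using that by (intro linear_local_rep c) auto
  have MY: "(M x *v ?Y l x) $ i = (if idx4 i = l then 1 else 0)" if x: "x \<in> ?S" and "l \<in> {1..4}" for x i l
  proof -
    obtain p where p: "p \<in> fst c" "p \<in> V" "x = snd c p" using x by auto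
    have "(M x *v ?Y l x) $ i = local_rep A c (\<omega> (idx4 i)) x (?Y l x)"
      unfolding M_def by (rule coframe_matrix_mult_vector[OF lin[OF x]])
    also have "\<dots> = \<omega> (idx4 i) p (E p l)" using p c by (simp add: local_rep_jac)
    finally show ?thesis using assms(3)[OF p(2)] that(2) idx4_mem unfolding dual_frame_def by metis
  qed
  have det: "det (M x) \<noteq> 0" if x: "x \<in> ?S" for x
  proof -
    \<comment> \<open>The components of all four dual vectors form a right inverse of
      \<open>M x\<close>, so its determinant is nonzero.\<close>
    define B :: "real^4^4" where "B = (\<chi> k l. ?Y (idx4 l) x $ k)"
    have "(M x ** B) $ i $ l = mat 1 $ i $ l" for i l
    proof -
      have "(M x ** B) $ i $ l = (M x *v ?Y (idx4 l) x) $ i"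
        by (simp add: matrix_vector_mult_def matrix_matrix_mult_def B_def)
      also have "\<dots> = (if idx4 i = idx4 l then 1 else 0)" by (rule MY[OF x idx4_mem])
      finally show ?thesis using inj_idx4 by (simp add: mat_def inj_eq)
    qed
    then have "M x ** B = mat 1" by (simp add: vec_eq_iff)
    then show ?thesis by (metis invertible_det_nz invertible_right_inverse)
  qed
  have Ms: "smooth_on ?S (\<lambda>x. M x $ i $ k)" for i k
    using smooth_1formD[OF assms(2)[OF idx4_mem] c] by (simp add: M_def coframe_matrix_def)
  have Ns: "smooth_on ?S (\<lambda>x. N k x $ i $ l)" for k i l
    using Ms[of i l] by (cases "l = k") (simp_all add: N_def)
  have "smooth_on ?S (\<lambda>x. det (N k x) / det (M x))" for k
    by (intro smooth_on_divide smooth_on_det S Ms Ns det)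
  moreover have cram: "?Y j x $ k = det (N k x) / det (M x)" if x: "x \<in> ?S" for x k
  proof -
    have "M x *v ?Y j x = y"
      by (simp only: y_def vec_eq_iff MY[OF x assms(4)] vec_lambda_beta simp_thms)
    then have "?Y j x = (\<chi> k. det (N k x) / det (M x))"
      unfolding N_def using cramer[OF det[OF x]] by blast
    from arg_cong[OF this, of "\<lambda>z. z $ k"] show ?thesis by simp
  qed
  ultimately have comp: "smooth_on ?S (\<lambda>x. ?Y j x $ k)" for k
    by (rule_tac smooth_on_cong[OF S]) (simp_all only: cram)
  show "smooth_on ?S (?Y j)"
  proof (rule smooth_on_componentwise[OF S])
    fix b :: "real^4" assume "b \<in> Basis"
    then obtain k where b: "b = axis k 1" by (auto simp: Basis_vec_def)
    show "smooth_on ?S (\<lambda>x. ?Y j x \<bullet> b)"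
      using comp[of k] by (simp add: b inner_axis)
  qed
qed

end

section \<open>The function \<open>p\<^sub>3\<close>\<close>

text \<open>Each permutation of 0, 1, 2 is uniquely a product of transpositions (0 i)(1 j) with j at
  least 1. Wedge products thereby become explicit finite sums.\<close>

lemma sum_permutations_3:
  fixes g :: "(nat \<Rightarrow> nat) \<Rightarrow> real"
  shows "(\<Sum>\<sigma> | \<sigma> permutes {..<3}. g \<sigma>) =
    (\<Sum>i\<in>{0,1,2}. \<Sum>j\<in>{1,2}. g (Transposition.transpose 0 i \<circ> (Transposition.transpose 1 j \<circ> id)))"
proof -
  have "{..<3::nat} = insert 0 (insert 1 {2})" by auto
  then show ?thesis by (simp add: sum_over_permutations_insert permutes_sing)
qed

lemma sum_permutations_4:
  fixes g :: "(nat \<Rightarrow> nat) \<Rightarrow> real"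
  shows "(\<Sum>\<sigma> | \<sigma> permutes {..<4}. g \<sigma>) =
    (\<Sum>i\<in>{0,1,2,3}. \<Sum>j\<in>{1,2,3}. \<Sum>k\<in>{2,3}.
      g (Transposition.transpose 0 i \<circ> (Transposition.transpose 1 j \<circ> (Transposition.transpose 2 k \<circ> id))))"
proof -
  have "{..<4::nat} = insert 0 (insert 1 (insert 2 {3}))" by auto
  then show ?thesis by (simp add: sum_over_permutations_insert permutes_sing)
qed

lemmas sign_transpositions =
  sign_compose sign_swap_id sign_id permutation_swap_id permutation_compose permutation_id

lemma wedge_1_2:
  assumes "\<And>u v. \<eta> [v, u] = - \<eta> [u, v]"
  shows "wedge 1 2 \<alpha> \<eta> [x, y, z] = \<alpha> [x] * \<eta> [y, z] - \<alpha> [y] * \<eta> [x, z] + \<alpha> [z] * \<eta> [x, y]"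
proof -
  have n: "1 + 2 = (3::nat)" "[0..<1] = [0::nat]" "[1..<3] = [1, 2::nat]" by (simp_all add: upt_rec)
  show ?thesis
    unfolding wedge_def n sum_permutations_3
    by (simp add: sign_transpositions Transposition.transpose_def fact_numeral
        assms[of y x] assms[of z x] assms[of z y] field_simps)
qed

text \<open>The two adjacent swaps generate all permutations of three arguments, so the 24 terms
  form four groups of six equal ones, cancelling 3!.\<close>

lemma wedge_3_1:
  assumes "\<And>u v w. \<eta> [v, u, w] = - \<eta> [u, v, w]" "\<And>u v w. \<eta> [u, w, v] = - \<eta> [u, v, w]"
  shows "wedge 3 1 \<eta> \<beta> [x, y, z, w] =
    \<eta> [x, y, z] * \<beta> [w] - \<eta> [x, y, w] * \<beta> [z] + \<eta> [x, z, w] * \<beta> [y] - \<eta> [y, z, w] * \<beta> [x]"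
proof -
  have n: "3 + 1 = (4::nat)" "[0..<3] = [0, 1, 2::nat]" "[3..<4] = [3::nat]" by (simp_all add: upt_rec)
  have p: "\<eta> [a, c, b] = - \<eta> [a, b, c]" "\<eta> [b, a, c] = - \<eta> [a, b, c]" "\<eta> [b, c, a] = \<eta> [a, b, c]"
    "\<eta> [c, a, b] = \<eta> [a, b, c]" "\<eta> [c, b, a] = - \<eta> [a, b, c]" for a b c
    using assms by (metis add.inverse_inverse)+
  show ?thesis
    unfolding wedge_def n sum_permutations_4
    by (simp add: sign_transpositions Transposition.transpose_def fact_numeral
        p[where a=x and b=y and c=z] p[where a=x and b=y and c=w] p[where a=x and b=z and c=w]
        p[where a=y and b=z and c=w] field_simps)
qed

text \<open>The 24 terms yield three ways of pairing the arguments, eight times each; division by 2!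
  2! leaves the factor 2.\<close>

lemma wedge_2_2:
  assumes "\<And>u v. \<eta> [v, u] = - \<eta> [u, v]"
  shows "wedge 2 2 \<eta> \<eta> [x, y, z, w] =
    2 * (\<eta> [x, y] * \<eta> [z, w] - \<eta> [x, z] * \<eta> [y, w] + \<eta> [x, w] * \<eta> [y, z])"
proof -
  have n: "2 + 2 = (4::nat)" "[0..<2] = [0, 1::nat]" "[2..<4] = [2, 3::nat]" by (simp_all add: upt_rec)
  show ?thesis
    unfolding wedge_def n sum_permutations_4
    by (simp add: sign_transpositions Transposition.transpose_def fact_numeral
        assms[of y x] assms[of z x] assms[of z y] assms[of w x] assms[of w y] assms[of w z] field_simps)
qed

section \<open>Adapted coframings\<close>

lemma wedge_cov_vanish:
  "blinfun_apply \<alpha> u = 0 \<Longrightarrow> blinfun_apply \<alpha> v = 0 \<Longrightarrow> (\<alpha> \<^bold>\<and> \<beta>) [u, v] = 0"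
  unfolding wedge_cov_apply by simp

lemma span_pair_vanish:
  assumes "\<alpha> \<in> span {\<beta>, \<gamma>}" "blinfun_apply \<beta> u = 0" "blinfun_apply \<gamma> u = 0"
  shows "blinfun_apply \<alpha> u = 0"
  using assms by (auto simp: span_pair blinfun.add_left blinfun.scaleR_left)

text \<open>Turns a congruence into an equation: on the common kernel of \<open>J\<close>, every
  generator of the ideal evaluates to zero.\<close>

lemma cong2_mod_vanish:
  assumes "cong2_mod J \<eta> \<eta>'" "\<And>\<alpha>. \<alpha> \<in> J \<Longrightarrow> blinfun_apply \<alpha> u = 0" "\<And>\<alpha>. \<alpha> \<in> J \<Longrightarrow> blinfun_apply \<alpha> v = 0"
  shows "\<eta> [u, v] = \<eta>' [u, v]"
proof -
  obtain n :: nat and \<alpha> \<beta> where J: "\<And>i. i < n \<Longrightarrow> \<alpha> i \<in> J"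
    and eq: "\<And>u v. \<eta> [u, v] = \<eta>' [u, v] + (\<Sum>i<n. (\<alpha> i \<^bold>\<and> \<beta> i) [u, v])"
    using assms(1) unfolding cong2_mod_def by blast
  have "(\<Sum>i<n. (\<alpha> i \<^bold>\<and> \<beta> i) [u, v]) = 0"
    using J assms(2,3) by (intro sum.neutral ballI wedge_cov_vanish) auto
  with eq show ?thesis by simp
qed

text \<open>Two differentials have twelve coefficients in a dual frame. Seven are prescribed here;
  the other five, on pairs ending in \<open>E 1\<close>, are the free functions a, b of the first
  equation and c, e, f of the second.\<close>

definition normalized ::
  "('a, real^4) chart set \<Rightarrow> (nat \<Rightarrow> 'a \<Rightarrow> (real^4) covector) \<Rightarrow> 'a \<Rightarrow> (nat \<Rightarrow> real^4) \<Rightarrow> bool" where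
  "normalized A \<omega> p E \<longleftrightarrow>
    d1 A (\<omega> 1) p [E 3, E 4] = 0 \<and> d1 A (\<omega> 1) p [E 3, E 2] = 1 \<and>
    d1 A (\<omega> 1) p [E 4, E 2] = 0 \<and> d1 A (\<omega> 1) p [E 2, E 1] = 0 \<and>
    d1 A (\<omega> 2) p [E 3, E 4] = 1 \<and> d1 A (\<omega> 2) p [E 3, E 2] = 0 \<and> d1 A (\<omega> 2) p [E 4, E 2] = 0"

context manifold4
begin

section \<open>Differentials of sections of I and of its derived system\<close>

lemma d1_expand:
  assumes "openin X V" "smooth_1form A V \<theta>" "p \<in> V" "dual_frame w E"
  shows "d1 A \<theta> p [u, v] =
    d1 A \<theta> p [E 2, E 1] * (w 2 u * w 1 v - w 2 v * w 1 u)
    + d1 A \<theta> p [E 3, E 1] * (w 3 u * w 1 v - w 3 v * w 1 u)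
    + d1 A \<theta> p [E 4, E 1] * (w 4 u * w 1 v - w 4 v * w 1 u)
    + d1 A \<theta> p [E 3, E 2] * (w 3 u * w 2 v - w 3 v * w 2 u)
    + d1 A \<theta> p [E 4, E 2] * (w 4 u * w 2 v - w 4 v * w 2 u)
    + d1 A \<theta> p [E 3, E 4] * (w 3 u * w 4 v - w 3 v * w 4 u)"
  by (rule bilinear_alternating_expand[OF assms(4) bilinear_d1[OF assms(1-3)] d1_swap])

text \<open>Both Leibniz corrections vanish on vectors annihilated by \<theta> and \<eta>. This is
  the tensoriality behind the bundle map \<delta>.\<close>

lemma d1_combination:
  assumes "openin X V" "smooth_fun A V f" "smooth_fun A V g" "smooth_1form A V \<theta>" "smooth_1form A V \<eta>"
    "p \<in> V" "\<theta> p u = 0" "\<theta> p v = 0" "\<eta> p u = 0" "\<eta> p v = 0"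
  shows "d1 A (\<lambda>q. f q *\<^sub>R \<theta> q + g q *\<^sub>R \<eta> q) p [u, v] = f p * d1 A \<theta> p [u, v] + g p * d1 A \<eta> p [u, v]"
proof -
  obtain \<gamma> where \<gamma>: "\<And>u v. d1 A (\<lambda>q. f q *\<^sub>R \<theta> q) p [u, v] =
      f p * d1 A \<theta> p [u, v] + (\<gamma> u * \<theta> p v - \<gamma> v * \<theta> p u)"
    using d1_scaleR[OF assms(1,2,4,6)] by blast
  obtain \<gamma>' where \<gamma>': "\<And>u v. d1 A (\<lambda>q. g q *\<^sub>R \<eta> q) p [u, v] =
      g p * d1 A \<eta> p [u, v] + (\<gamma>' u * \<eta> p v - \<gamma>' v * \<eta> p u)"
    using d1_scaleR[OF assms(1,3,5,6)] by blast
  show ?thesis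
    by (subst d1_add[OF assms(1) _ _ assms(6)])
      (use assms in \<open>simp_all add: smooth_1form_scaleR \<gamma> \<gamma>' del: One_nat_def\<close>)
qed

lemma coframing_smooth: "coframing A V \<omega> \<Longrightarrow> i \<in> {1..4} \<Longrightarrow> smooth_1form A V (\<omega> i)"
  unfolding coframing_def by blast

lemma coframingI:
  assumes "\<And>i. i \<in> {1..4} \<Longrightarrow> smooth_1form A V (\<omega> i)"
    "\<And>p. p \<in> V \<Longrightarrow> dual_frame (\<lambda>i. \<omega> i p) (E p)"
  shows "coframing A V \<omega>"
  unfolding coframing_def using assms(1) dual_frame_imp_independent[OF assms(2)] by blast

lemma coframing_dual_smooth:
  assumes "openin X V" "coframing A V \<omega>" "\<And>p. p \<in> V \<Longrightarrow> dual_frame (\<lambda>i. \<omega> i p) (E p)" "j \<in> {1..4}"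
  shows "smooth_vector_field A V (\<lambda>p. E p j)"
  by (rule dual_frame_smooth[OF assms(1) coframing_smooth[OF assms(2)] assms(3,4)])

lemma coframing_d1_coefficient_smooth:
  assumes "openin X V" "coframing A V \<omega>" "\<And>p. p \<in> V \<Longrightarrow> dual_frame (\<lambda>i. \<omega> i p) (E p)"
    "i \<in> {1..4}" "j \<in> {1..4}" "k \<in> {1..4}"
  shows "smooth_fun A V (\<lambda>p. d1 A (\<omega> i) p [E p j, E p k])"
  by (rule smooth_fun_d1_vector_fields[OF assms(1) coframing_smooth[OF assms(2,4)]
      coframing_dual_smooth[OF assms(1-3,5)] coframing_dual_smooth[OF assms(1-3,6)]])

lemma zero_adaptedI:
  assumes "\<And>i. i \<in> {1..4} \<Longrightarrow> smooth_1form A V (\<omega> i)"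
    "\<And>p. p \<in> V \<Longrightarrow> dual_frame (\<lambda>i. \<omega> i p) (E p)"
    "\<And>p u v. p \<in> V \<Longrightarrow> \<Omega> p [u, v] = (\<omega> 1 p \<^bold>\<and> \<omega> 3 p) [u, v] + (\<omega> 2 p \<^bold>\<and> \<omega> 4 p) [u, v]"
    "\<And>p. p \<in> V \<Longrightarrow> annihilator D p = span {\<omega> 1 p, \<omega> 2 p}"
    "\<And>p. p \<in> V \<Longrightarrow> derived_system X A (annihilator D) p = span {\<omega> 1 p}"
  shows "zero_adapted X A \<Omega> D V \<omega>"
  unfolding zero_adapted_def using coframingI[OF assms(1,2)] assms(3-5) by blast

lemma zero_adaptedD:
  assumes "zero_adapted X A \<Omega> D V \<omega>"
  shows "coframing A V \<omega>"
    "\<And>p u v. p \<in> V \<Longrightarrow> \<Omega> p [u, v] = (\<omega> 1 p \<^bold>\<and> \<omega> 3 p) [u, v] + (\<omega> 2 p \<^bold>\<and> \<omega> 4 p) [u, v]"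
    "\<And>p. p \<in> V \<Longrightarrow> annihilator D p = span {\<omega> 1 p, \<omega> 2 p}"
    "\<And>p. p \<in> V \<Longrightarrow> derived_system X A (annihilator D) p = span {\<omega> 1 p}"
  using assms unfolding zero_adapted_def by blast+

text \<open>The coefficients of \<theta> are its values on \<open>E 1\<close> and
  \<open>E 2\<close>, which are smooth because the dual frame is; tensoriality then applies.\<close>

lemma d1_of_span_pair:
  assumes "openin X V" "\<And>i. i \<in> {1..4} \<Longrightarrow> smooth_1form A V (\<omega> i)"
    and E: "\<And>q. q \<in> V \<Longrightarrow> dual_frame (\<lambda>i. \<omega> i q) (E q)"
    and \<theta>: "smooth_1form A V \<theta>" "\<And>q. q \<in> V \<Longrightarrow> \<theta> q \<in> span {\<omega> 1 q, \<omega> 2 q}"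
    and p: "p \<in> V" "\<omega> 1 p u = 0" "\<omega> 1 p v = 0" "\<omega> 2 p u = 0" "\<omega> 2 p v = 0"
  shows "d1 A \<theta> p [u, v] =
    \<theta> p (E p 1) * d1 A (\<omega> 1) p [u, v] + \<theta> p (E p 2) * d1 A (\<omega> 2) p [u, v]"
proof -
  note dual = dual_frameD[OF E]
  have f: "smooth_fun A V (\<lambda>q. \<theta> q (E q 1))" "smooth_fun A V (\<lambda>q. \<theta> q (E q 2))"
    by (rule smooth_fun_apply_vector_field[OF assms(1) \<theta>(1) dual_frame_smooth[OF assms(1-3)]]; simp)+
  have eq: "\<theta> q (E q 1) *\<^sub>R \<omega> 1 q + \<theta> q (E q 2) *\<^sub>R \<omega> 2 q = \<theta> q" if "q \<in> V" for q
  proof -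
    from \<theta>(2)[OF that] obtain s t where "\<theta> q = s *\<^sub>R \<omega> 1 q + t *\<^sub>R \<omega> 2 q"
      by (auto simp: span_pair)
    then show ?thesis
      using dual[OF that] by (simp add: blinfun.add_left blinfun.scaleR_left del: One_nat_def)
  qed
  have s: "smooth_1form A V (\<omega> 1)" "smooth_1form A V (\<omega> 2)"
    using assms(2)[of 1] assms(2)[of 2] by simp_all
  have comb: "smooth_1form A V (\<lambda>q. \<theta> q (E q 1) *\<^sub>R \<omega> 1 q + \<theta> q (E q 2) *\<^sub>R \<omega> 2 q)"
    by (intro smooth_1form_add smooth_1form_scaleR assms(1) f s)
  have "d1 A \<theta> p [u, v] =
      d1 A (\<lambda>q. \<theta> q (E q 1) *\<^sub>R \<omega> 1 q + \<theta> q (E q 2) *\<^sub>R \<omega> 2 q) p [u, v]"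
    by (rule d1_cong[OF assms(1) comb eq p(1)])
  also have "\<dots> = \<theta> p (E p 1) * d1 A (\<omega> 1) p [u, v] + \<theta> p (E p 2) * d1 A (\<omega> 2) p [u, v]"
    by (rule d1_combination[OF assms(1) f s p])
  finally show ?thesis .
qed

lemma d1_of_span_singleton:
  assumes "openin X V" "\<And>i. i \<in> {1..4} \<Longrightarrow> smooth_1form A V (\<omega> i)"
    and E: "\<And>q. q \<in> V \<Longrightarrow> dual_frame (\<lambda>i. \<omega> i q) (E q)"
    and \<theta>: "smooth_1form A V \<theta>" "\<And>q. q \<in> V \<Longrightarrow> \<theta> q \<in> span {\<omega> 1 q}"
    and p: "p \<in> V" "\<omega> 1 p u = 0" "\<omega> 1 p v = 0"
  shows "d1 A \<theta> p [u, v] = \<theta> p (E p 1) * d1 A (\<omega> 1) p [u, v]"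
proof -
  note dual = dual_frameD[OF E]
  have f: "smooth_fun A V (\<lambda>q. \<theta> q (E q 1))"
    by (rule smooth_fun_apply_vector_field[OF assms(1) \<theta>(1) dual_frame_smooth[OF assms(1-3)]]; simp)
  have eq: "\<theta> q (E q 1) *\<^sub>R \<omega> 1 q = \<theta> q" if "q \<in> V" for q
  proof -
    from \<theta>(2)[OF that] obtain s where "\<theta> q = s *\<^sub>R \<omega> 1 q"
      by (auto simp: span_singleton)
    then show ?thesis
      using dual[OF that] by (simp add: blinfun.scaleR_left del: One_nat_def)
  qed
  have s: "smooth_1form A V (\<omega> 1)"
    using assms(2)[of 1] by simp
  obtain \<gamma> where \<gamma>: "\<And>u v. d1 A (\<lambda>q. \<theta> q (E q 1) *\<^sub>R \<omega> 1 q) p [u, v] =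
      \<theta> p (E p 1) * d1 A (\<omega> 1) p [u, v] + (\<gamma> u * \<omega> 1 p v - \<gamma> v * \<omega> 1 p u)"
    using d1_scaleR[OF assms(1) f s p(1)] by blast
  have "d1 A \<theta> p [u, v] = d1 A (\<lambda>q. \<theta> q (E q 1) *\<^sub>R \<omega> 1 q) p [u, v]"
    by (rule d1_cong[OF assms(1) smooth_1form_scaleR[OF assms(1) f s] eq p(1)])
  then show ?thesis by (simp only: \<gamma> p mult_zero_right diff_self add_0_right)
qed

text \<open>By definition of the derived system, some section \<open>\<theta>\<close> of \<open>I\<close> through \<open>\<omega>\<^sub>1 p\<close>
  has \<open>d\<theta>\<close> congruent to \<open>0\<close> modulo \<open>I\<close> at \<open>p\<close>; that class depends only on \<open>\<theta> p\<close>.\<close>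

lemma zero_adapted_d1_first:
  assumes "openin X V" "zero_adapted X A \<Omega> D V \<omega>" "p \<in> V"
    and E: "\<And>p. p \<in> V \<Longrightarrow> dual_frame (\<lambda>i. \<omega> i p) (E p)"
  shows "d1 A (\<omega> 1) p [E p 3, E p 4] = 0"
proof -
  note z = zero_adaptedD[OF assms(2)]
  note dual = dual_frameD[OF E[OF assms(3)]]
  have "\<omega> 1 p \<in> derived_system X A (annihilator D) p"
    using z(4)[OF assms(3)] by (simp add: span_base)
  then obtain W \<theta> where W: "openin X W" "p \<in> W" "smooth_1form A W \<theta>"
      "\<And>q. q \<in> W \<Longrightarrow> \<theta> q \<in> annihilator D q" "\<theta> p = \<omega> 1 p"
      "cong2_mod (annihilator D p) (d1 A \<theta> p) (\<lambda>_. 0)"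
    unfolding derived_system_def by blast
  \<comment> \<open>Comparing differentials needs a neighbourhood on which \<theta> is a section of
    I and the coframing is available at once.\<close>
  let ?W = "W \<inter> V"
  have o: "openin X ?W" and pW: "p \<in> ?W" using W assms by auto
  have \<theta>: "smooth_1form A ?W \<theta>" by (rule smooth_1form_subset[OF W(3)]) simp
  have \<omega>: "smooth_1form A ?W (\<omega> i)" if "i \<in> {1..4}" for i
    by (rule smooth_1form_subset[OF coframing_smooth[OF z(1) that]]) simp
  have "\<theta> q \<in> span {\<omega> 1 q, \<omega> 2 q}" if "q \<in> ?W" for q
    using W(4)[of q] z(3)[of q] that by blast
  then have "d1 A \<theta> p [E p 3, E p 4] = \<theta> p (E p 1) * d1 A (\<omega> 1) p [E p 3, E p 4]
      + \<theta> p (E p 2) * d1 A (\<omega> 2) p [E p 3, E p 4]"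
    by (intro d1_of_span_pair[OF o \<omega> E \<theta>]) (use dual pW in auto)
  also have "\<dots> = d1 A (\<omega> 1) p [E p 3, E p 4]"
    by (simp only: W(5) dual)
  finally have "d1 A \<theta> p [E p 3, E p 4] = d1 A (\<omega> 1) p [E p 3, E p 4]" .
  moreover have "d1 A \<theta> p [E p 3, E p 4] = 0"
    by (rule cong2_mod_vanish[OF W(6)]; unfold z(3)[OF assms(3)]; erule span_pair_vanish)
      (simp_all only: dual)
  ultimately show ?thesis by simp
qed

text \<open>Wedging with \<open>\<omega> 1\<close> and \<open>\<omega> 4\<close> kills every term of
  the differential of \<open>\<omega> 1\<close> except the one in \<omega>3 \<and> \<omega>2, while
  \<Omega> \<and> \<Omega> is twice \<omega>1 \<and> \<omega>3 \<and> \<omega>2 \<and>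
  \<omega>4.\<close>

lemma p3_eq:
  assumes "openin X V" "zero_adapted X A \<Omega> D V \<omega>" "p \<in> V"
    and E: "\<And>p. p \<in> V \<Longrightarrow> dual_frame (\<lambda>i. \<omega> i p) (E p)"
  shows "p3 A \<Omega> \<omega> p = d1 A (\<omega> 1) p [E p 3, E p 2]"
proof -
  note z = zero_adaptedD[OF assms(2)]
  define P where "P = d1 A (\<omega> 1) p [E p 3, E p 2]"
  define L where "L = wedge 3 1 (wedge 1 2 (cov (\<omega> 1 p)) (d1 A (\<omega> 1) p)) (cov (\<omega> 4 p))"
  define R where "R = wedge 2 2 (\<Omega> p) (\<Omega> p)"
  define w where "w i = blinfun_apply (\<omega> i p)" for i
  have w: "cov (\<omega> i p) [u] = w i u" for i u by (simp add: cov_def w_def)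
  have \<Omega>: "\<Omega> p [u, v] = w 1 u * w 3 v - w 1 v * w 3 u + (w 2 u * w 4 v - w 2 v * w 4 u)" for u v
    by (simp only: z(2)[OF assms(3)] wedge_cov_apply w_def)
  have one: "(1::nat) \<in> {1..4}" by simp
  define x where "x = d1 A (\<omega> 1) p [E p 2, E p 1]"
  define a where "a = d1 A (\<omega> 1) p [E p 3, E p 1]"
  define b where "b = d1 A (\<omega> 1) p [E p 4, E p 1]"
  \<comment> \<open>This is p4. It survives the product with \<open>\<omega> 1\<close> and
    disappears only through the last factor \<open>\<omega> 4\<close>.\<close>
  define c where "c = d1 A (\<omega> 1) p [E p 4, E p 2]"
  have d: "d1 A (\<omega> 1) p [u, v] =
      x * (w 2 u * w 1 v - w 2 v * w 1 u) + a * (w 3 u * w 1 v - w 3 v * w 1 u)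
      + b * (w 4 u * w 1 v - w 4 v * w 1 u) + P * (w 3 u * w 2 v - w 3 v * w 2 u)
      + c * (w 4 u * w 2 v - w 4 v * w 2 u)" for u v
    using d1_expand[OF assms(1) coframing_smooth[OF z(1) one] assms(3) E[OF assms(3)], of u v]
    by (simp only: zero_adapted_d1_first[OF assms] w_def mult_zero_left add_0_right
        x_def a_def b_def c_def P_def)
  have w12: "wedge 1 2 (cov (\<omega> 1 p)) (d1 A (\<omega> 1) p) [u, v, y] =
      P * (w 1 u * (w 3 v * w 2 y - w 3 y * w 2 v) - w 1 v * (w 3 u * w 2 y - w 3 y * w 2 u)
        + w 1 y * (w 3 u * w 2 v - w 3 v * w 2 u))
      + c * (w 1 u * (w 4 v * w 2 y - w 4 y * w 2 v) - w 1 v * (w 4 u * w 2 y - w 4 y * w 2 u)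
        + w 1 y * (w 4 u * w 2 v - w 4 v * w 2 u))" for u v y
    by (subst wedge_1_2, rule d1_swap) (simp add: d w algebra_simps del: One_nat_def)
  have LR: "L [u, v, y, x] = P / 2 * R [u, v, y, x]" for u v y x
  proof -
    have 1: "L [u, v, y, x] = wedge 1 2 (cov (\<omega> 1 p)) (d1 A (\<omega> 1) p) [u, v, y] * w 4 x
      - wedge 1 2 (cov (\<omega> 1 p)) (d1 A (\<omega> 1) p) [u, v, x] * w 4 y
      + wedge 1 2 (cov (\<omega> 1 p)) (d1 A (\<omega> 1) p) [u, y, x] * w 4 v
      - wedge 1 2 (cov (\<omega> 1 p)) (d1 A (\<omega> 1) p) [v, y, x] * w 4 u"
      unfolding L_def w[symmetric]
      by (rule wedge_3_1) (simp_all add: w12 algebra_simps del: One_nat_def)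
    have 2: "R [u, v, y, x] =
        2 * (\<Omega> p [u, v] * \<Omega> p [y, x] - \<Omega> p [u, y] * \<Omega> p [v, x] + \<Omega> p [u, x] * \<Omega> p [v, y])"
      unfolding R_def by (rule wedge_2_2) (simp add: \<Omega>)
    show ?thesis
      unfolding 1 2 w12 \<Omega> by (simp add: field_simps del: One_nat_def)
  qed
  show ?thesis
    unfolding p3_def L_def[symmetric] R_def[symmetric] P_def[symmetric]
  proof (rule the_equality)
    show "\<forall>vs. length vs = 4 \<longrightarrow> L vs = P / 2 * R vs"
      by (auto simp: length_Suc_conv numeral_eq_Suc LR)
  next
    fix t assume t: "\<forall>vs. length vs = 4 \<longrightarrow> L vs = t / 2 * R vs"
    \<comment> \<open>The order puts the conjugate pairs of \<Omega> side by side, so only the first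
      product contributes; the nonzero value 2 determines \<open>t\<close>.\<close>
    let ?vs = "[E p 1, E p 3, E p 2, E p 4]"
    have "R ?vs = 2 * (\<Omega> p [E p 1, E p 3] * \<Omega> p [E p 2, E p 4]
        - \<Omega> p [E p 1, E p 2] * \<Omega> p [E p 3, E p 4] + \<Omega> p [E p 1, E p 4] * \<Omega> p [E p 3, E p 2])"
      unfolding R_def by (rule wedge_2_2) (simp add: \<Omega>)
    also have "\<dots> = 2"
      unfolding \<Omega> w_def by (simp only: dual_frameD[OF E[OF assms(3)]]) simp
    finally have R: "R ?vs = 2" .
    have "L ?vs = t / 2 * R ?vs" using t by simp
    then show "t = P" unfolding LR R by simp
  qed
qed

lemma d1_bilinear:
  assumes "openin X V" "smooth_1form A V \<theta>" "p \<in> V"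
  shows "d1 A \<theta> p [u + u', v] = d1 A \<theta> p [u, v] + d1 A \<theta> p [u', v]"
    "d1 A \<theta> p [u - u', v] = d1 A \<theta> p [u, v] - d1 A \<theta> p [u', v]"
    "d1 A \<theta> p [s *\<^sub>R u, v] = s * d1 A \<theta> p [u, v]"
    "d1 A \<theta> p [u, v + v'] = d1 A \<theta> p [u, v] + d1 A \<theta> p [u, v']"
    "d1 A \<theta> p [u, v - v'] = d1 A \<theta> p [u, v] - d1 A \<theta> p [u, v']"
    "d1 A \<theta> p [u, s *\<^sub>R v] = s * d1 A \<theta> p [u, v]"
    "d1 A \<theta> p [u, u] = 0"
proof -
  note B = bilinear_d1[OF assms]
  show "d1 A \<theta> p [u + u', v] = d1 A \<theta> p [u, v] + d1 A \<theta> p [u', v]"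
    "d1 A \<theta> p [u - u', v] = d1 A \<theta> p [u, v] - d1 A \<theta> p [u', v]"
    "d1 A \<theta> p [u, v + v'] = d1 A \<theta> p [u, v] + d1 A \<theta> p [u, v']"
    "d1 A \<theta> p [u, v - v'] = d1 A \<theta> p [u, v] - d1 A \<theta> p [u, v']"
    by (rule bilinear_ladd[OF B] bilinear_lsub[OF B] bilinear_radd[OF B] bilinear_rsub[OF B])+
  show "d1 A \<theta> p [s *\<^sub>R u, v] = s * d1 A \<theta> p [u, v]" "d1 A \<theta> p [u, s *\<^sub>R v] = s * d1 A \<theta> p [u, v]"
    using bilinear_lmul[OF B, of s u v] bilinear_rmul[OF B, of u s v] by simp_all
  show "d1 A \<theta> p [u, u] = 0" using d1_swap[of A \<theta> p u u] by simp
qed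

lemma zero_adapted_subset:
  "zero_adapted X A \<Omega> D V \<omega> \<Longrightarrow> W \<subseteq> V \<Longrightarrow> zero_adapted X A \<Omega> D W \<omega>"
  unfolding zero_adapted_def coframing_def using smooth_1form_subset[of V _ W] by blast

lemma one_adapted_subset:
  "one_adapted X A \<Omega> D V \<omega> \<Longrightarrow> W \<subseteq> V \<Longrightarrow> one_adapted X A \<Omega> D W \<omega>"
  unfolding one_adapted_def using zero_adapted_subset by blast

lemma structure_coframing_subset:
  "structure_coframing X A \<Omega> D V \<omega> \<Longrightarrow> W \<subseteq> V \<Longrightarrow> structure_coframing X A \<Omega> D W \<omega>"
  unfolding structure_coframing_def structure_equations_def
  using zero_adapted_subset[of \<Omega> D V \<omega> W] smooth_fun_subset[of V _ W] by (meson subsetD)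

lemma structure_coframing_normalized:
  assumes "structure_coframing X A \<Omega> D V \<omega>" "p \<in> V" "dual_frame (\<lambda>i. \<omega> i p) E"
  shows "normalized A \<omega> p E"
proof -
  obtain a b c e f where eq: "structure_equations A V \<omega> a b c e f"
    using assms(1) unfolding structure_coframing_def by blast
  show ?thesis
    using eq[unfolded structure_equations_def, rule_format, OF assms(2)]
    unfolding normalized_def wedge_cov_apply
    by (simp add: dual_frameD[OF assms(3)] blinfun.add_left blinfun.scaleR_left del: One_nat_def)
qed

text \<open>The free functions are the remaining coefficients in the dual frame, hence smooth as
  evaluations of differentials on smooth fields.\<close>

lemma structure_coframingI:
  assumes "openin X V" "zero_adapted X A \<Omega> D V \<omega>"
    and E: "\<And>p. p \<in> V \<Longrightarrow> dual_frame (\<lambda>i. \<omega> i p) (E p)"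
    and N: "\<And>p. p \<in> V \<Longrightarrow> normalized A \<omega> p (E p)"
  shows "structure_coframing X A \<Omega> D V \<omega>"
proof -
  note z = zero_adaptedD(1)[OF assms(2)]
  let ?d = "\<lambda>i j k p. d1 A (\<omega> i) p [E p j, E p k]"
  have sm: "smooth_fun A V (?d i j k)" if "i \<in> {1..4}" "j \<in> {1..4}" "k \<in> {1..4}" for i j k
    by (rule coframing_d1_coefficient_smooth[OF assms(1) z E that])
  have "structure_equations A V \<omega> (?d 1 3 1) (?d 1 4 1) (?d 2 2 1) (?d 2 3 1) (?d 2 4 1)"
    unfolding structure_equations_def
  proof (intro ballI allI conjI)
    fix p u v assume p: "p \<in> V"
    have one: "(1::nat) \<in> {1..4}" and two: "(2::nat) \<in> {1..4}" by simp_all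
    note n = N[OF p, unfolded normalized_def]
    show "d1 A (\<omega> 1) p [u, v] = (\<omega> 3 p \<^bold>\<and> \<omega> 2 p) [u, v] +
        ((?d 1 3 1 p *\<^sub>R \<omega> 3 p + ?d 1 4 1 p *\<^sub>R \<omega> 4 p) \<^bold>\<and> \<omega> 1 p) [u, v]"
      unfolding wedge_cov_apply
      by (subst d1_expand[OF assms(1) coframing_smooth[OF z one] p E[OF p]])
        (simp add: n blinfun.add_left blinfun.scaleR_left algebra_simps del: One_nat_def)
    show "d1 A (\<omega> 2) p [u, v] =
        ((?d 2 2 1 p *\<^sub>R \<omega> 2 p + ?d 2 3 1 p *\<^sub>R \<omega> 3 p + ?d 2 4 1 p *\<^sub>R \<omega> 4 p) \<^bold>\<and> \<omega> 1 p) [u, v]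
        + (\<omega> 3 p \<^bold>\<and> \<omega> 4 p) [u, v]"
      unfolding wedge_cov_apply
      by (subst d1_expand[OF assms(1) coframing_smooth[OF z two] p E[OF p]])
        (simp add: n blinfun.add_left blinfun.scaleR_left algebra_simps del: One_nat_def)
  qed
  moreover have "smooth_fun A V (?d 1 3 1)" "smooth_fun A V (?d 1 4 1)" "smooth_fun A V (?d 2 2 1)"
    "smooth_fun A V (?d 2 3 1)" "smooth_fun A V (?d 2 4 1)"
    by (rule sm; simp)+
  ultimately show ?thesis using assms(2) unfolding structure_coframing_def by blast
qed

section \<open>Pointwise uniqueness\<close>

text \<open>The numbers a, b, s, t are the diagonal entries relating two solutions. The first two
  equations express invariance of \<Omega>, the last two the normalizations. Elimination gives b =
  a^2 and a^5 = 1, and 1 is the only real fifth root of 1.\<close>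

lemma scaling_unique:
  fixes a b s t :: real
  assumes "a * s = 1" "b * t = 1" "s * t = b" "s * b = a"
  shows "a = 1" "b = 1"
proof -
  have b: "b = a * a" using assms(1,4) by algebra
  have "a ^ 5 = 1" using assms by algebra
  then have "root 5 (a ^ 5) = 1" by simp
  then show "a = 1" by (simp add: odd_real_root_power_cancel)
  with b show "b = 1" by simp
qed

text \<open>One solution is evaluated on the dual frame of the other. The entries
  \<open>m i j\<close> are forced to be those of the identity by the flag conditions, by \<Omega>,
  and by comparing the values of the differentials.\<close>

lemma structure_coframing_unique:
  assumes o: "openin X V" and s: "structure_coframing X A \<Omega> D V \<omega>" "structure_coframing X A \<Omega> D V \<omega>'"
    and "p \<in> V" "i \<in> {1..4}"
  shows "\<omega>' i p = \<omega> i p"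
proof -
  have z: "zero_adapted X A \<Omega> D V \<omega>" "zero_adapted X A \<Omega> D V \<omega>'"
    using s unfolding structure_coframing_def by blast+
  note z1 = zero_adaptedD[OF z(1)] and z2 = zero_adaptedD[OF z(2)]
  note sm = coframing_smooth[OF z1(1)] and sm' = coframing_smooth[OF z2(1)]
  obtain E where E: "\<And>q. q \<in> V \<Longrightarrow> dual_frame (\<lambda>i. \<omega> i q) (E q)"
    using coframing_dual_exists[OF z1(1)] by blast
  obtain a b c e f where eq: "structure_equations A V \<omega>' a b c e f"
    using s(2) unfolding structure_coframing_def by blast
  note eqs = eq[unfolded structure_equations_def wedge_cov_apply blinfun.add_left blinfun.scaleR_left, rule_format]
  have s12: "smooth_1form A V (\<omega>' 1)" "smooth_1form A V (\<omega>' 2)"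
    using sm'[of 1] sm'[of 2] by simp_all
  have sp1: "\<omega>' 1 q \<in> span {\<omega> 1 q}" and sp2: "\<omega>' 2 q \<in> span {\<omega> 1 q, \<omega> 2 q}" if "q \<in> V" for q
    using z1(3,4)[OF that] z2(3,4)[OF that] by (auto intro: span_base)
  have \<Omega>: "\<omega>' 1 q u * \<omega>' 3 q v - \<omega>' 1 q v * \<omega>' 3 q u + (\<omega>' 2 q u * \<omega>' 4 q v - \<omega>' 2 q v * \<omega>' 4 q u)
      = \<omega> 1 q u * \<omega> 3 q v - \<omega> 1 q v * \<omega> 3 q u + (\<omega> 2 q u * \<omega> 4 q v - \<omega> 2 q v * \<omega> 4 q u)"
    if "q \<in> V" for q u v
    using z1(2)[OF that, of u v] z2(2)[OF that, of u v] unfolding wedge_cov_apply by linarith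
  \<comment> \<open>Established on all of \<open>V\<close>, because equality of
    \<open>\<omega>' 1\<close> and \<open>\<omega> 1\<close> at \<open>p\<close> alone would not
    identify their differentials there.\<close>
  have stage1: "\<omega>' 1 q = \<omega> 1 q \<and> \<omega>' 2 q = \<omega> 2 q \<and> \<omega>' 3 q (E q 3) = 1 \<and> \<omega>' 3 q (E q 4) = 0 \<and>
      \<omega>' 4 q (E q 3) = 0 \<and> \<omega>' 4 q (E q 4) = 1" if q: "q \<in> V" for q
  proof -
    note dual = dual_frameD[OF E[OF q]]
    note n = structure_coframing_normalized[OF s(1) q E[OF q], unfolded normalized_def]
    define m where "m i j = \<omega>' i q (E q j)" for i j
    have v1: "m 1 2 = 0" "m 1 3 = 0" "m 1 4 = 0"
      using span_pair_vanish[of "\<omega>' 1 q" "\<omega> 1 q" "\<omega> 1 q"] sp1[OF q] dual by (simp_all add: m_def del: One_nat_def)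
    have v2: "m 2 3 = 0" "m 2 4 = 0"
      using span_pair_vanish[OF sp2[OF q]] dual by (simp_all add: m_def del: One_nat_def)
    have om: "m 1 1 * m 3 3 + m 2 1 * m 4 3 = 1" "m 1 1 * m 3 4 + m 2 1 * m 4 4 = 0"
      "m 2 2 * m 4 3 = 0" "m 2 2 * m 4 4 = 1"
      using \<Omega>[OF q, of "E q 1" "E q 3"] \<Omega>[OF q, of "E q 1" "E q 4"] \<Omega>[OF q, of "E q 2" "E q 3"]
        \<Omega>[OF q, of "E q 2" "E q 4"] v1 v2
      by (simp_all add: dual del: One_nat_def flip: m_def)
    have d: "d1 A (\<omega>' 1) q [E q 3, E q 2] = m 1 1" "d1 A (\<omega>' 1) q [E q 4, E q 2] = 0"
      using d1_of_span_singleton[OF o sm E s12(1) sp1 q] dual n by (simp_all add: m_def del: One_nat_def)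
    have d': "d1 A (\<omega>' 2) q [E q 3, E q 4] = m 2 2"
      using d1_of_span_pair[OF o sm E s12(2) sp2 q] dual n by (simp add: m_def del: One_nat_def)
    have e: "m 3 3 * m 2 2 = m 1 1" "m 3 4 * m 2 2 = 0" "m 3 3 * m 4 4 - m 3 4 * m 4 3 = m 2 2"
      using eqs[OF q, of "E q 3" "E q 2"] eqs[OF q, of "E q 4" "E q 2"] eqs[OF q, of "E q 3" "E q 4"]
        d d' v1 v2 by (simp_all del: One_nat_def flip: m_def)
    have nz: "m 2 2 \<noteq> 0" using om(4) by auto
    have h: "m 4 3 = 0" "m 3 4 = 0" using om(3) e(2) nz by simp_all
    have u: "m 1 1 = 1" "m 2 2 = 1"
      using scaling_unique[of "m 1 1" "m 3 3" "m 2 2" "m 4 4"] om e h by simp_all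
    have r: "m 3 3 = 1" "m 4 4 = 1" "m 2 1 = 0" using om u h by simp_all
    have "\<omega>' 1 q = \<omega> 1 q" "\<omega>' 2 q = \<omega> 2 q"
      by (rule dual_frame_covector_eqI[OF E[OF q]];
          use dual v1 v2 u r in \<open>auto simp: atLeastAtMost_1_4 m_def simp del: One_nat_def\<close>)+
    then show ?thesis using r h by (simp add: m_def del: One_nat_def)
  qed
  note dual = dual_frameD[OF E[OF \<open>p \<in> V\<close>]]
  note n = structure_coframing_normalized[OF s(1) \<open>p \<in> V\<close> E[OF \<open>p \<in> V\<close>], unfolded normalized_def]
  define m where "m i j = \<omega>' i p (E p j)" for i j
  have st: "\<omega>' 1 p = \<omega> 1 p" "\<omega>' 2 p = \<omega> 2 p" "m 3 3 = 1" "m 3 4 = 0" "m 4 3 = 0" "m 4 4 = 1"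
    using stage1[OF \<open>p \<in> V\<close>] by (simp_all add: m_def del: One_nat_def)
  have d: "d1 A (\<omega>' 1) p [u, v] = d1 A (\<omega> 1) p [u, v]" "d1 A (\<omega>' 2) p [u, v] = d1 A (\<omega> 2) p [u, v]" for u v
    by (rule d1_cong[OF o _ _ \<open>p \<in> V\<close>]; use sm[of 1] sm[of 2] stage1 in auto)+
  \<comment> \<open>What remains is a symmetric 2 by 2 block. The second structure equation removes
    \<open>m 4 2\<close> and \<open>m 3 2\<close>; then the pair (E2, E1) in the first removes
    \<open>m 3 1\<close>.\<close>
  have 1: "m 3 2 = m 4 1"
    using \<Omega>[OF \<open>p \<in> V\<close>, of "E p 1" "E p 2"] by (simp add: st dual del: One_nat_def flip: m_def)
  have 2: "m 4 2 = 0" "m 3 2 = 0"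
    using eqs[OF \<open>p \<in> V\<close>, of "E p 3" "E p 2"] eqs[OF \<open>p \<in> V\<close>, of "E p 4" "E p 2"] n
    by (simp_all add: d st dual del: One_nat_def flip: m_def)
  have 3: "m 3 1 = 0"
    using eqs[OF \<open>p \<in> V\<close>, of "E p 2" "E p 1"] n 2 by (simp add: d st dual del: One_nat_def flip: m_def)
  have "\<omega>' 3 p = \<omega> 3 p" "\<omega>' 4 p = \<omega> 4 p"
    by (rule dual_frame_covector_eqI[OF E[OF \<open>p \<in> V\<close>]];
        use dual st 1 2 3 in \<open>auto simp: atLeastAtMost_1_4 m_def simp del: One_nat_def\<close>)+
  with st \<open>i \<in> {1..4}\<close> show ?thesis
    unfolding atLeastAtMost_1_4 by auto
qed

end

section \<open>Existence by explicit normalization\<close>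

definition quadruple :: "'b \<Rightarrow> 'b \<Rightarrow> 'b \<Rightarrow> 'b \<Rightarrow> nat \<Rightarrow> 'b" where
  "quadruple a b c d i = (if i = 1 then a else if i = 2 then b else if i = 3 then c else d)"

lemma quadruple_apply:
  "quadruple a b c d 1 = a" "quadruple a b c d 2 = b" "quadruple a b c d 3 = c" "quadruple a b c d 4 = d"
  by (simp_all add: quadruple_def)

context manifold4
begin

text \<open>The coefficients \<open>1/r\<^sup>2\<close> and \<open>r\<close> keep the coframing \<open>1\<close>-adapted, and such a scaling
  divides \<open>p\<^sub>3\<close> by \<open>r\<^sup>5\<close>; adding a multiple of \<open>\<omega>\<^sub>1\<close> to \<open>\<omega>\<^sub>2\<close> then removes
  \<open>p\<^sub>4\<close>.\<close>

lemma normalize_first: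
  assumes o: "openin X V" and one: "one_adapted X A \<Omega> D V \<omega>"
    and E: "\<And>p. p \<in> V \<Longrightarrow> dual_frame (\<lambda>i. \<omega> i p) (E p)"
    and nz: "\<And>p. p \<in> V \<Longrightarrow> d1 A (\<omega> 1) p [E p 3, E p 2] \<noteq> 0"
  shows "\<exists>\<omega>' E'. zero_adapted X A \<Omega> D V \<omega>' \<and> (\<forall>p\<in>V. dual_frame (\<lambda>i. \<omega>' i p) (E' p) \<and>
    d1 A (\<omega>' 1) p [E' p 3, E' p 4] = 0 \<and> d1 A (\<omega>' 1) p [E' p 3, E' p 2] = 1 \<and>
    d1 A (\<omega>' 1) p [E' p 4, E' p 2] = 0 \<and> d1 A (\<omega>' 2) p [E' p 3, E' p 4] = 1)"
proof -
  have zero: "zero_adapted X A \<Omega> D V \<omega>" using one unfolding one_adapted_def by blast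
  note z = zero_adaptedD[OF zero]
  note sm = coframing_smooth[OF z(1)]
  define P where "P p = d1 A (\<omega> 1) p [E p 3, E p 2]" for p
  define Q where "Q p = d1 A (\<omega> 1) p [E p 4, E p 2]" for p
  define r where "r p = root 5 (P p)" for p
  define t where "t p = Q p / P p" for p
  have P: "smooth_fun A V P" and Q: "smooth_fun A V Q"
    unfolding P_def Q_def by (rule coframing_d1_coefficient_smooth[OF o z(1) E]; simp)+
  have P0: "P p \<noteq> 0" if "p \<in> V" for p using nz[OF that] unfolding P_def .
  have r: "smooth_fun A V r" unfolding r_def by (rule smooth_fun_root[OF o P P0]) simp_all
  have t: "smooth_fun A V t" unfolding t_def by (rule smooth_fun_divide[OF o Q P P0])
  have r0: "r p \<noteq> 0" if "p \<in> V" for p using P0[OF that] by (simp add: r_def)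
  have r5: "r p ^ 5 = P p" for p by (simp add: r_def odd_real_root_pow)
  define s where "s p = 1 / r p" for p
  have s: "smooth_fun A V s" unfolding s_def by (rule smooth_fun_divide[OF o smooth_fun_const r r0])
  have rs: "r p * s p = 1" if "p \<in> V" for p using r0[OF that] by (simp add: s_def)
  \<comment> \<open>With the first two forms prescribed, the third and fourth are the choice that
    preserves \<Omega>: the term in \<open>t\<close> added to \<open>\<omega> 3\<close> cancels the
    one subtracted from \<open>\<omega> 2\<close>.\<close>
  define \<omega>' where "\<omega>' = quadruple
    (\<lambda>p. (s p * s p) *\<^sub>R \<omega> 1 p)
    (\<lambda>p. r p *\<^sub>R \<omega> 2 p + (- (r p * t p)) *\<^sub>R \<omega> 1 p)
    (\<lambda>p. (r p * r p) *\<^sub>R \<omega> 3 p + (r p * r p * t p) *\<^sub>R \<omega> 4 p)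
    (\<lambda>p. s p *\<^sub>R \<omega> 4 p)"
  define E' where "E' p = quadruple
    ((r p * r p) *\<^sub>R E p 1 + (r p * r p * t p) *\<^sub>R E p 2)
    (s p *\<^sub>R E p 2)
    ((s p * s p) *\<^sub>R E p 3)
    (r p *\<^sub>R E p 4 - (r p * t p) *\<^sub>R E p 3)" for p
  have w: "\<omega>' 1 = (\<lambda>p. (s p * s p) *\<^sub>R \<omega> 1 p)"
    "\<omega>' 2 = (\<lambda>p. r p *\<^sub>R \<omega> 2 p + (- (r p * t p)) *\<^sub>R \<omega> 1 p)"
    "\<omega>' 3 = (\<lambda>p. (r p * r p) *\<^sub>R \<omega> 3 p + (r p * r p * t p) *\<^sub>R \<omega> 4 p)"
    "\<omega>' 4 = (\<lambda>p. s p *\<^sub>R \<omega> 4 p)"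
    unfolding \<omega>'_def by (rule quadruple_apply)+
  have e: "E' p 1 = (r p * r p) *\<^sub>R E p 1 + (r p * r p * t p) *\<^sub>R E p 2" "E' p 2 = s p *\<^sub>R E p 2"
    "E' p 3 = (s p * s p) *\<^sub>R E p 3" "E' p 4 = r p *\<^sub>R E p 4 - (r p * t p) *\<^sub>R E p 3" for p
    unfolding E'_def by (rule quadruple_apply)+
  have "smooth_1form A V (\<omega>' 1)" "smooth_1form A V (\<omega>' 2)" "smooth_1form A V (\<omega>' 3)"
    "smooth_1form A V (\<omega>' 4)"
    unfolding w
    by (intro smooth_1form_add smooth_1form_scaleR smooth_fun_mult smooth_fun_minus o r s t sm; simp)+
  then have sm': "smooth_1form A V (\<omega>' i)" if "i \<in> {1..4}" for i
    using that unfolding atLeastAtMost_1_4 by (elim insertE) auto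
  have E': "dual_frame (\<lambda>i. \<omega>' i p) (E' p)" if p: "p \<in> V" for p
  proof -
    have "r p * (r p * (s p * s p)) = 1" using rs[OF p] by algebra
    with rs[OF p] show ?thesis
      unfolding dual_frame_def atLeastAtMost_1_4
      by (simp add: w e dual_frameD[OF E[OF p]] blinfun.add_left blinfun.diff_left blinfun.scaleR_left
          blinfun.add_right blinfun.diff_right blinfun.scaleR_right algebra_simps del: One_nat_def)
  qed
  have "zero_adapted X A \<Omega> D V \<omega>'"
  proof (rule zero_adaptedI[OF sm' E'])
    fix p assume p: "p \<in> V"
    note k = rs[OF p]
    show "\<Omega> p [u, v] = (\<omega>' 1 p \<^bold>\<and> \<omega>' 3 p) [u, v] + (\<omega>' 2 p \<^bold>\<and> \<omega>' 4 p) [u, v]" for u v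
      unfolding z(2)[OF p] wedge_cov_apply w blinfun.add_left blinfun.scaleR_left real_scaleR_def
      using k by algebra
    have nz: "s p * s p \<noteq> 0" "r p \<noteq> 0" using k by auto
    show "annihilator D p = span {\<omega>' 1 p, \<omega>' 2 p}"
      unfolding z(3)[OF p] w by (rule span_lower_triangular[OF nz, symmetric])
    show "derived_system X A (annihilator D) p = span {\<omega>' 1 p}"
      unfolding z(4)[OF p] w by (rule span_scaleR_singleton[OF nz(1), symmetric])
  qed
  moreover have "d1 A (\<omega>' 1) p [E' p 3, E' p 4] = 0" "d1 A (\<omega>' 1) p [E' p 3, E' p 2] = 1"
    "d1 A (\<omega>' 1) p [E' p 4, E' p 2] = 0" "d1 A (\<omega>' 2) p [E' p 3, E' p 4] = 1" if p: "p \<in> V" for p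
  proof -
    note k = rs[OF p]
    note dual = dual_frameD[OF E[OF p]]
    have s1: "smooth_1form A V (\<omega> 1)" and s2: "smooth_1form A V (\<omega> 2)"
      using sm[of 1] sm[of 2] by simp_all
    note bil1 = d1_bilinear[OF o s1 p] and bil2 = d1_bilinear[OF o s2 p]
    have sp1: "\<omega>' 1 q \<in> span {\<omega> 1 q}" for q unfolding w by (intro span_scale span_base) simp
    have sp2: "\<omega>' 2 q \<in> span {\<omega> 1 q, \<omega> 2 q}" for q
      unfolding w by (intro span_add span_scale span_base) simp_all
    have sm1: "smooth_1form A V (\<omega>' 1)" and sm2: "smooth_1form A V (\<omega>' 2)"
      using sm'[of 1] sm'[of 2] by simp_all
    have d1: "d1 A (\<omega>' 1) p [u, v] = (s p * s p) * d1 A (\<omega> 1) p [u, v]"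
      if "\<omega> 1 p u = 0" "\<omega> 1 p v = 0" for u v
      using d1_of_span_singleton[OF o sm E sm1 sp1 p that]
      by (simp add: w dual blinfun.scaleR_left del: One_nat_def)
    have d2: "d1 A (\<omega>' 2) p [u, v] = - (r p * t p) * d1 A (\<omega> 1) p [u, v] + r p * d1 A (\<omega> 2) p [u, v]"
      if "\<omega> 1 p u = 0" "\<omega> 1 p v = 0" "\<omega> 2 p u = 0" "\<omega> 2 p v = 0" for u v
      using d1_of_span_pair[OF o sm E sm2 sp2 p that]
      by (simp add: w dual blinfun.scaleR_left blinfun.diff_left algebra_simps del: One_nat_def)
    have v: "\<omega> 1 p (E' p 2) = 0" "\<omega> 1 p (E' p 3) = 0" "\<omega> 1 p (E' p 4) = 0"
      "\<omega> 2 p (E' p 3) = 0" "\<omega> 2 p (E' p 4) = 0"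
      by (simp_all add: e dual blinfun.scaleR_right blinfun.diff_right del: One_nat_def)
    have c1: "d1 A (\<omega> 1) p [E p 3, E p 4] = 0"
      by (rule zero_adapted_d1_first[OF o zero p E])
    \<comment> \<open>Here 1-adaptedness enters: E3 and E4 lie in the common kernel of
      \<open>\<omega> 1\<close> and \<open>\<omega> 2\<close>, so the congruence becomes an equality
      on them.\<close>
    have c2: "d1 A (\<omega> 2) p [E p 3, E p 4] = 1"
    proof -
      have "cong2_mod {\<omega> 1 p, \<omega> 2 p} (d1 A (\<omega> 2) p) (\<omega> 3 p \<^bold>\<and> \<omega> 4 p)"
        using one p unfolding one_adapted_def by blast
      then have "d1 A (\<omega> 2) p [E p 3, E p 4] = (\<omega> 3 p \<^bold>\<and> \<omega> 4 p) [E p 3, E p 4]"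
        by (rule cong2_mod_vanish) (auto simp: dual simp del: One_nat_def)
      then show ?thesis unfolding wedge_cov_apply by (simp add: dual)
    qed
    have tP: "t p * P p = Q p" using P0[OF p] by (simp add: t_def)
    show "d1 A (\<omega>' 1) p [E' p 3, E' p 4] = 0"
      unfolding d1[OF v(2,3)] by (simp add: e bil1 c1 del: One_nat_def)
    have "d1 A (\<omega>' 1) p [E' p 3, E' p 2] = (s p * s p) * ((s p * s p) * (s p * P p))"
      unfolding d1[OF v(2,1)] by (simp add: e bil1 P_def del: One_nat_def)
    also have "\<dots> = 1" using k r5[of p] by algebra
    finally show "d1 A (\<omega>' 1) p [E' p 3, E' p 2] = 1" .
    have "d1 A (\<omega>' 1) p [E' p 4, E' p 2] = (s p * s p) * (s p * (r p * Q p - r p * t p * P p))"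
      unfolding d1[OF v(3,1)] by (simp add: e bil1 P_def Q_def algebra_simps del: One_nat_def)
    also have "\<dots> = 0" by (simp add: mult.assoc tP)
    finally show "d1 A (\<omega>' 1) p [E' p 4, E' p 2] = 0" .
    have "d1 A (\<omega>' 2) p [E' p 3, E' p 4] = r p * ((s p * s p) * r p)"
      unfolding d2[OF v(2,3,4,5)] by (simp add: e bil1 bil2 c1 c2 del: One_nat_def)
    also have "\<dots> = 1" using k by algebra
    finally show "d1 A (\<omega>' 2) p [E' p 3, E' p 4] = 1" .
  qed
  ultimately show ?thesis using E' by blast
qed

lemma normalize_second:
  assumes o: "openin X V" and zero: "zero_adapted X A \<Omega> D V \<omega>"
    and E: "\<And>p. p \<in> V \<Longrightarrow> dual_frame (\<lambda>i. \<omega> i p) (E p)"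
    and N: "\<And>p. p \<in> V \<Longrightarrow> d1 A (\<omega> 1) p [E p 3, E p 4] = 0"
      "\<And>p. p \<in> V \<Longrightarrow> d1 A (\<omega> 1) p [E p 3, E p 2] = 1"
      "\<And>p. p \<in> V \<Longrightarrow> d1 A (\<omega> 1) p [E p 4, E p 2] = 0"
      "\<And>p. p \<in> V \<Longrightarrow> d1 A (\<omega> 2) p [E p 3, E p 4] = 1"
  shows "\<exists>\<omega>'. structure_coframing X A \<Omega> D V \<omega>'"
proof -
  note z = zero_adaptedD[OF zero]
  note sm = coframing_smooth[OF z(1)]
  have dsm: "smooth_fun A V (\<lambda>p. d1 A (\<omega> i) p [E p j, E p k])"
    if "i \<in> {1..4}" "j \<in> {1..4}" "k \<in> {1..4}" for i j k
    by (rule coframing_d1_coefficient_smooth[OF o z(1) E that])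
  \<comment> \<open>Replacing E2 by E2 - x E3 - y E4 adds x to the value on (E4, E2) and subtracts y
    from the value on (E3, E2), since the value on (E3, E4) is 1. Both must become zero.\<close>
  define x where "x p = - d1 A (\<omega> 2) p [E p 4, E p 2]" for p
  define y where "y p = d1 A (\<omega> 2) p [E p 3, E p 2]" for p
  \<comment> \<open>With \<open>x\<close> and \<open>y\<close> known, the condition on (E2, E1) for
    the first differential is linear in \<open>s\<close>, with coefficient 1 because the value on
    (E3, E2) is 1.\<close>
  define s where "s p = x p * d1 A (\<omega> 1) p [E p 3, E p 1] + y p * d1 A (\<omega> 1) p [E p 4, E p 1]
    - d1 A (\<omega> 1) p [E p 2, E p 1]" for p
  have xs: "smooth_fun A V x" unfolding x_def by (intro smooth_fun_minus o dsm) simp_all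
  have ys: "smooth_fun A V y" unfolding y_def by (rule dsm) simp_all
  have ss: "smooth_fun A V s"
    unfolding s_def by (intro smooth_fun_add smooth_fun_diff smooth_fun_mult o dsm xs ys) simp_all
  define \<omega>' where "\<omega>' = quadruple (\<omega> 1) (\<omega> 2)
    (\<lambda>p. \<omega> 3 p + (s p *\<^sub>R \<omega> 1 p + x p *\<^sub>R \<omega> 2 p)) (\<lambda>p. \<omega> 4 p + (x p *\<^sub>R \<omega> 1 p + y p *\<^sub>R \<omega> 2 p))"
  \<comment> \<open>The dual frame changes by minus the transpose of the block added to the
    coframing; the block is symmetric, as \<Omega> demands.\<close>
  define E' where "E' p = quadruple (E p 1 - s p *\<^sub>R E p 3 - x p *\<^sub>R E p 4)
    (E p 2 - x p *\<^sub>R E p 3 - y p *\<^sub>R E p 4) (E p 3) (E p 4)" for p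
  have w: "\<omega>' 1 = \<omega> 1" "\<omega>' 2 = \<omega> 2" "\<omega>' 3 = (\<lambda>p. \<omega> 3 p + (s p *\<^sub>R \<omega> 1 p + x p *\<^sub>R \<omega> 2 p))"
    "\<omega>' 4 = (\<lambda>p. \<omega> 4 p + (x p *\<^sub>R \<omega> 1 p + y p *\<^sub>R \<omega> 2 p))"
    unfolding \<omega>'_def by (rule quadruple_apply)+
  have e: "E' p 1 = E p 1 - s p *\<^sub>R E p 3 - x p *\<^sub>R E p 4"
    "E' p 2 = E p 2 - x p *\<^sub>R E p 3 - y p *\<^sub>R E p 4" "E' p 3 = E p 3" "E' p 4 = E p 4" for p
    unfolding E'_def by (rule quadruple_apply)+
  have "smooth_1form A V (\<omega>' 1)" "smooth_1form A V (\<omega>' 2)" "smooth_1form A V (\<omega>' 3)"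
    "smooth_1form A V (\<omega>' 4)"
    unfolding w by (intro smooth_1form_add smooth_1form_scaleR o xs ys ss sm; simp)+
  then have sm': "smooth_1form A V (\<omega>' i)" if "i \<in> {1..4}" for i
    using that unfolding atLeastAtMost_1_4 by (elim insertE) auto
  have E': "dual_frame (\<lambda>i. \<omega>' i p) (E' p)" if p: "p \<in> V" for p
    unfolding dual_frame_def atLeastAtMost_1_4
    by (simp add: w e dual_frameD[OF E[OF p]] blinfun.add_left blinfun.scaleR_left
        blinfun.diff_right blinfun.scaleR_right del: One_nat_def)
  have zero': "zero_adapted X A \<Omega> D V \<omega>'"
  proof (rule zero_adaptedI[OF sm' E'])
    fix p assume p: "p \<in> V"
    show "\<Omega> p [u, v] = (\<omega>' 1 p \<^bold>\<and> \<omega>' 3 p) [u, v] + (\<omega>' 2 p \<^bold>\<and> \<omega>' 4 p) [u, v]" for u v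
      unfolding z(2)[OF p] wedge_cov_apply w blinfun.add_left blinfun.scaleR_left real_scaleR_def
      by algebra
  qed (simp_all only: w z)
  have "normalized A \<omega>' p (E' p)" if p: "p \<in> V" for p
  proof -
    have s1: "smooth_1form A V (\<omega> 1)" and s2: "smooth_1form A V (\<omega> 2)"
      using sm[of 1] sm[of 2] by simp_all
    note bil1 = d1_bilinear[OF o s1 p] and bil2 = d1_bilinear[OF o s2 p]
    have n: "d1 A (\<omega> 1) p [E p 4, E p 3] = 0" "d1 A (\<omega> 1) p [E p 2, E p 3] = -1"
      "d1 A (\<omega> 1) p [E p 2, E p 4] = 0" "d1 A (\<omega> 2) p [E p 4, E p 3] = -1"
      by (subst d1_swap, simp only: N[OF p] minus_zero)+
    show ?thesis
      unfolding normalized_def w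
      by (simp add: e bil1 bil2 N[OF p] n s_def x_def y_def algebra_simps del: One_nat_def)
  qed
  then show ?thesis using structure_coframingI[OF o zero' E'] by blast
qed

section \<open>Local solutions and gluing\<close>

text \<open>Membership gives p3 nonzero at one point only. As a coefficient in a smooth dual frame,
  p3 stays nonzero on an open \<open>W\<close>, and the same 1-adapted coframing witnesses that
  \<open>W\<close> lies in the domain.\<close>

lemma p3_domain_local:
  assumes "p \<in> p3_domain X A \<Omega> D"
  shows "\<exists>W \<omega>. openin X W \<and> p \<in> W \<and> W \<subseteq> p3_domain X A \<Omega> D \<and> structure_coframing X A \<Omega> D W \<omega>"
proof -
  obtain V \<omega> where V: "openin X V" "p \<in> V" "one_adapted X A \<Omega> D V \<omega>" "p3 A \<Omega> \<omega> p \<noteq> 0"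
    using assms unfolding p3_domain_def by blast
  have zero: "zero_adapted X A \<Omega> D V \<omega>" using V(3) unfolding one_adapted_def by blast
  obtain E where E: "\<And>q. q \<in> V \<Longrightarrow> dual_frame (\<lambda>i. \<omega> i q) (E q)"
    using coframing_dual_exists[OF zero_adaptedD(1)[OF zero]] by blast
  have P: "p3 A \<Omega> \<omega> q = d1 A (\<omega> 1) q [E q 3, E q 2]" if "q \<in> V" for q
    by (rule p3_eq[OF V(1) zero that E])
  define W where "W = {q \<in> V. d1 A (\<omega> 1) q [E q 3, E q 2] \<noteq> 0}"
  have W: "openin X W"
    unfolding W_def
    by (rule openin_smooth_fun_nonzero[OF V(1) coframing_d1_coefficient_smooth[OF V(1)
          zero_adaptedD(1)[OF zero] E]]) simp_all
  have sub: "W \<subseteq> V" by (auto simp: W_def)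
  have W_dom: "W \<subseteq> p3_domain X A \<Omega> D"
  proof
    fix q assume "q \<in> W"
    then have "q \<in> V" "p3 A \<Omega> \<omega> q \<noteq> 0" using P by (auto simp: W_def simp del: One_nat_def)
    with V(1,3) show "q \<in> p3_domain X A \<Omega> D" unfolding p3_domain_def by blast
  qed
  have pW: "p \<in> W" using V(2,4) P[OF V(2)] unfolding W_def by simp
  have "\<exists>\<omega>'. structure_coframing X A \<Omega> D W \<omega>'"
  proof -
    have EW: "dual_frame (\<lambda>i. \<omega> i q) (E q)" "d1 A (\<omega> 1) q [E q 3, E q 2] \<noteq> 0" if "q \<in> W" for q
      using that E[of q] unfolding W_def by simp_all
    from normalize_first[OF W one_adapted_subset[OF V(3) sub] EW]
    obtain \<omega>' E' where "zero_adapted X A \<Omega> D W \<omega>'" "\<forall>p\<in>W. dual_frame (\<lambda>i. \<omega>' i p) (E' p) \<and>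
        d1 A (\<omega>' 1) p [E' p 3, E' p 4] = 0 \<and> d1 A (\<omega>' 1) p [E' p 3, E' p 2] = 1 \<and>
        d1 A (\<omega>' 1) p [E' p 4, E' p 2] = 0 \<and> d1 A (\<omega>' 2) p [E' p 3, E' p 4] = 1"
      by metis
    then show ?thesis by (intro normalize_second[OF W, of \<Omega> D \<omega>' E']) simp_all
  qed
  with W pW W_dom show ?thesis by blast
qed

text \<open>Each point uses the value of the coframing chosen for it. Uniqueness on
  \<open>W p \<inter> W q\<close> shows that the result agrees with \<open>\<eta> p\<close>
  throughout \<open>W p\<close>, hence is smooth. The functions a, b, c, e, f need no gluing, as
  normalization at every point gives them back.\<close>

lemma structure_coframing_glue:
  assumes loc: "\<And>p. p \<in> U \<Longrightarrow> openin X (W p) \<and> p \<in> W p \<and> W p \<subseteq> U \<and> structure_coframing X A \<Omega> D (W p) (\<eta> p)"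
  shows "structure_coframing X A \<Omega> D U (\<lambda>i p. \<eta> p i p)"
proof -
  let ?\<omega> = "\<lambda>i p. \<eta> p i p"
  have o: "openin X U"
    by (subst openin_subopen) (use loc in blast)
  have eq: "\<eta> p i q = ?\<omega> i q" if "p \<in> U" "q \<in> W p" "i \<in> {1..4}" for p q i
  proof (rule structure_coframing_unique[where V = "W p \<inter> W q" and \<omega> = "\<eta> q" and \<omega>' = "\<eta> p"])
    have q: "q \<in> U" using loc that by blast
    show "openin X (W p \<inter> W q)" "q \<in> W p \<inter> W q" using loc[OF that(1)] loc[OF q] that by auto
    show "structure_coframing X A \<Omega> D (W p \<inter> W q) (\<eta> q)" "structure_coframing X A \<Omega> D (W p \<inter> W q) (\<eta> p)"
      using loc[OF that(1)] loc[OF q] by (auto intro: structure_coframing_subset)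
  qed (fact that)
  have z: "zero_adapted X A \<Omega> D (W p) (\<eta> p)" if "p \<in> U" for p
    using loc[OF that] unfolding structure_coframing_def by blast
  have smW: "smooth_1form A (W p) (\<eta> p i)" if "p \<in> U" "i \<in> {1..4}" for p i
    by (rule coframing_smooth[OF zero_adaptedD(1)[OF z[OF that(1)]] that(2)])
  have sm: "smooth_1form A U (?\<omega> i)" if "i \<in> {1..4}" for i
  proof (rule smooth_1form_local)
    fix p assume p: "p \<in> U"
    have "smooth_1form A (W p) (?\<omega> i)"
      using loc[OF p] by (intro smooth_1form_cong[OF _ smW[OF p that] eq[OF p _ that]]) auto
    then show "\<exists>W. openin X W \<and> p \<in> W \<and> smooth_1form A W (?\<omega> i)" using loc[OF p] by blast
  qed
  have "\<exists>E. dual_frame (\<lambda>i. \<eta> p i p) E" if "p \<in> U" for p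
    using coframing_dual_exists[OF zero_adaptedD(1)[OF z[OF that]]] loc[OF that] by metis
  then obtain E where E: "\<And>p. p \<in> U \<Longrightarrow> dual_frame (\<lambda>i. ?\<omega> i p) (E p)" by metis
  have pt: "p \<in> W p" if "p \<in> U" for p using loc[OF that] by blast
  have "zero_adapted X A \<Omega> D U ?\<omega>"
    by (rule zero_adaptedI[OF sm E]) (assumption | rule zero_adaptedD(2-4)[OF z pt])+
  moreover have "normalized A ?\<omega> p (E p)" if p: "p \<in> U" for p
  proof -
    \<comment> \<open>Near \<open>p\<close> the glued form is \<open>\<eta> p i\<close>, although
      its definition selects a new coframing at each point; agreement on the open set
      \<open>W p\<close> equates the differentials.\<close>
    have "d1 A (?\<omega> i) p [u, v] = d1 A (\<eta> p i) p [u, v]" if "i \<in> {1..4}" for i u v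
      using loc[OF p] by (intro d1_cong[OF _ smW[OF p that] eq[OF p _ that]]) auto
    then have "d1 A (?\<omega> 1) p [u, v] = d1 A (\<eta> p 1) p [u, v]"
      "d1 A (?\<omega> 2) p [u, v] = d1 A (\<eta> p 2) p [u, v]" for u v
      by simp_all
    moreover have "normalized A (\<eta> p) p (E p)"
      by (rule structure_coframing_normalized[where V = "W p"]) (use loc[OF p] E[OF p] in auto)
    ultimately show ?thesis by (simp only: normalized_def)
  qed
  ultimately show ?thesis by (intro structure_coframingI[OF o _ E])
qed

end

theorem theorem2p2:
  fixes X :: "'a topology"
    and A :: "('a, real^4) chart set"
    and \<Omega> :: "'a \<Rightarrow> (real^4) form"
    and D :: "'a \<Rightarrow> (real^4) set"
  assumes "lagrangian_engel_structure X A \<Omega> D"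
  shows "\<exists>\<omega>. structure_coframing X A \<Omega> D (p3_domain X A \<Omega> D) \<omega> \<and>
    (\<forall>\<omega>'. structure_coframing X A \<Omega> D (p3_domain X A \<Omega> D) \<omega>' \<longrightarrow>
       (\<forall>p\<in>p3_domain X A \<Omega> D. \<forall>i\<in>{1..4}. \<omega>' i p = \<omega> i p))"
proof -
  interpret manifold4 X A
    by unfold_locales (use assms in \<open>simp add: lagrangian_engel_structure_def\<close>)
  let ?U = "p3_domain X A \<Omega> D"
  obtain W \<eta> where loc: "\<And>p. p \<in> ?U \<Longrightarrow>
      openin X (W p) \<and> p \<in> W p \<and> W p \<subseteq> ?U \<and> structure_coframing X A \<Omega> D (W p) (\<eta> p)"
    using p3_domain_local[of _ \<Omega> D] by metis
  have "openin X ?U"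
    by (subst openin_subopen) (use loc in blast)
  with structure_coframing_glue[OF loc] show ?thesis
    by (intro exI conjI allI impI ballI) (assumption, rule structure_coframing_unique)
qed

end
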